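(* Let $(\lambda,\mu,\aleph_0,\aleph_0)$ be suitable and $\mathfrak{B}=\mathfrak{B}^1_{2^\lambda,\mu}$. Then there exists a $(\lambda,\mu)$-perfect ultrafilter on $\mathfrak{B}$.
   Context: $(\lambda,\mu,\aleph_0,\aleph_0)$ suitable means $\aleph_0\le\mu<\lambda$ are infinite cardinals (the remaining suitability conditions $\mu=\mu^{<\aleph_0}$, $\lambda=\lambda^{<\aleph_0}$, $2^n<\mu$ for $n<\omega$ hold automatically). $\mathfrak{B}^1_{\beta,\mu}$ is the completion of the Boolean algebra generated by $\mathbf{x}_f$, $f$ ranging over finite functions from a subset of $\beta$ into $\mu$, freely subject to $\mathbf{x}_{f_2}\le\mathbf{x}_{f_1}$ for $f_1\subseteq f_2$ and $\mathbf{x}_f\cap\mathbf{x}_{f'}=0$ for incompatible $f,f'$; for $\alpha\le2^\lambda$, $\mathfrak{B}^+_{\alpha,\mu}$ denotes the nonzero elements of the complete subalgebra of $\mathfrak{B}$ generated by the $\mathbf{x}_f$ with $\mathrm{Dom}(f)\subseteq\alpha$. A support of $\bar{\mathbf{b}}=\langle\mathbf{b}_u:u\in[\lambda]^{<\aleph_0}\rangle$ is a set $X$ of generators $\mathbf{x}_f$ such that for each $u$ some maximal antichain of $\mathfrak{B}$ consists of elements of $X$ each $\le\mathbf{b}_u$ or $\le1-\mathbf{b}_u$. An ultrafilter $\mathcal{D}_*$ on $\mathfrak{B}$ is $(\lambda,\mu)$-perfect when (A) implies (B), where (A): $\bar{\mathbf{b}}$ is a monotonic (decreasing under inclusion) sequence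 of elements of $\mathcal{D}_*$ with a support $\mathrm{supp}(\bar{\mathbf{b}})$ of cardinality $\le\lambda$ such that for every $\alpha<2^\lambda$ with $\bigcup\{\mathrm{Dom}(f):\mathbf{x}_f\in\mathrm{supp}(\bar{\mathbf{b}})\}\subseteq\alpha$ there is a multiplicative sequence $\langle\mathbf{b}'_u:u\in[\lambda]^{<\aleph_0}\rangle$ of nonzero elements with (a) $\mathbf{b}'_u\le\mathbf{b}_u$ for all $u$ and (b) for every $\mathbf{c}\in\mathfrak{B}^+_{\alpha,\mu}\cap\mathcal{D}_*$, no intersection of finitely many members of $\{\mathbf{b}'_{\{i\}}\cup(1-\mathbf{b}_{\{i\}}):i<\lambda\}$ is disjoint to $\mathbf{c}$; (B): there is a multiplicative sequence $\langle\mathbf{b}'_u:u\in[\lambda]^{<\aleph_0}\rangle$ of elements of $\mathcal{D}_*$ with $\mathbf{b}'_u\le\mathbf{b}_u$ for all $u$. (Multiplicative: $\mathbf{b}'_{u_1}\cap\mathbf{b}'_{u_2}=\mathbf{b}'_{u_1\cup u_2}$.)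
   Formalization: The algebra is generated subject also to x_∅ = 1 and x_f ∩ x_g = x_{f∪g} for compatible f, g; with only the two listed families 1 − x_∅ is nonzero and disjoint from all generators, so no sequence would have a support and (A) would never hold. *)

theory Defs
  imports Main "HOL-Library.FSet" "HOL-Library.Finite_Map"
begin

unbundle cardinal_syntax

section \<open>The completion of a Boolean algebra\<close>

text \<open>
  The Dedekind--MacNeille completion by cuts.  The completion is an instance of
  \<^class>\<open>boolean_algebra\<close> and of \<^class>\<open>complete_lattice\<close>.  It is in general no instance of
  \<^class>\<open>complete_boolean_algebra\<close>, since that class demands complete distributivity
  (and so would only admit power set algebras).
\<close>

definition upper :: "'a::order set \<Rightarrow> 'a set" where
  "upper A = {x. \<forall>a\<in>A. a \<le> x}"

definition lower :: "'a::order set \<Rightarrow> 'a set" where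
  "lower A = {x. \<forall>a\<in>A. x \<le> a}"

lemma lower_upper_extensive: "A \<subseteq> lower (upper A)"
  by (auto simp: lower_def upper_def)

lemma lower_upper_mono: "A \<subseteq> B \<Longrightarrow> lower (upper A) \<subseteq> lower (upper B)"
  by (auto simp: lower_def upper_def)

lemma upper_lower_upper: "upper (lower (upper A)) = upper A"
  by (auto simp: lower_def upper_def)

lemma lower_upper_lower: "lower (upper (lower A)) = lower A"
  by (auto simp: lower_def upper_def)

lemma lower_upper_idem: "lower (upper (lower (upper A))) = lower (upper A)"
  by (simp add: upper_lower_upper)

lemma lower_upper_least: "A \<subseteq> B \<Longrightarrow> lower (upper B) = B \<Longrightarrow> lower (upper A) \<subseteq> B"
  using lower_upper_mono by blast

lemma lower_upper_Inter:
  assumes "\<And>A. A \<in> F \<Longrightarrow> lower (upper A) = A"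
  shows "lower (upper (\<Inter>F)) = \<Inter>F"
proof (rule antisym[OF _ lower_upper_extensive], rule Inter_greatest)
  fix A assume "A \<in> F"
  then show "lower (upper (\<Inter>F)) \<subseteq> A"
    using lower_upper_least[OF Inter_lower] assms by blast
qed

lemma lower_upper_Int:
  "lower (upper A) = A \<Longrightarrow> lower (upper B) = B \<Longrightarrow> lower (upper (A \<inter> B)) = A \<inter> B"
  using lower_upper_Inter[of "{A, B}"] by auto

definition disjoint_from :: "'a::boolean_algebra set \<Rightarrow> 'a set" where
  "disjoint_from A = {x. \<forall>a\<in>A. inf x a = bot}"

lemma upper_eq_disjoint_from: "upper A = uminus ` disjoint_from A"
proof -
  have "x \<in> upper A \<longleftrightarrow> - x \<in> disjoint_from A" for x
    by (simp add: upper_def disjoint_from_def inf_shunt inf.commute)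
  moreover have "x \<in> uminus ` disjoint_from A \<longleftrightarrow> - x \<in> disjoint_from A" for x
    by (metis boolean_algebra_class.boolean_algebra.double_compl image_iff)
  ultimately show ?thesis
    by blast
qed

lemma lower_uminus: "lower (uminus ` A) = disjoint_from A"
  by (auto simp: lower_def disjoint_from_def inf_shunt)

lemma lower_upper_eq: "lower (upper A) = disjoint_from (disjoint_from A)"
  by (simp add: upper_eq_disjoint_from lower_uminus)

lemma lower_upper_disjoint_from: "lower (upper (disjoint_from A)) = disjoint_from A"
  by (metis lower_uminus lower_upper_lower)

typedef (overloaded) 'a completion = "{A :: 'a::boolean_algebra set. lower (upper A) = A}"
  morphisms cut Abs_completion
  by (rule exI[of _ "lower (upper {})"]) (simp add: lower_upper_idem)

setup_lifting type_definition_completion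

instantiation completion :: (boolean_algebra) complete_lattice
begin

lift_definition less_eq_completion :: "'a completion \<Rightarrow> 'a completion \<Rightarrow> bool" is "(\<subseteq>)" .
lift_definition less_completion :: "'a completion \<Rightarrow> 'a completion \<Rightarrow> bool" is "(\<subset>)" .
lift_definition inf_completion :: "'a completion \<Rightarrow> 'a completion \<Rightarrow> 'a completion" is "(\<inter>)"
  by (rule lower_upper_Int)
lift_definition sup_completion :: "'a completion \<Rightarrow> 'a completion \<Rightarrow> 'a completion"
  is "\<lambda>A B. lower (upper (A \<union> B))" by (rule lower_upper_idem)
lift_definition bot_completion :: "'a completion" is "lower (upper {})"
  by (rule lower_upper_idem)
lift_definition top_completion :: "'a completion" is "UNIV"
  using lower_upper_extensive by blast
lift_definition Inf_completion :: "'a completion set \<Rightarrow> 'a completion" is "Inter"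
  by (rule lower_upper_Inter)
lift_definition Sup_completion :: "'a completion set \<Rightarrow> 'a completion"
  is "\<lambda>F. lower (upper (\<Union>F))" by (rule lower_upper_idem)

instance
proof
  fix x y z :: "'a completion" and A :: "'a completion set"
  note rep = less_eq_completion.rep_eq less_completion.rep_eq inf_completion.rep_eq
    sup_completion.rep_eq bot_completion.rep_eq top_completion.rep_eq
    Inf_completion.rep_eq Sup_completion.rep_eq
  have closed: "lower (upper (cut w)) = cut w" for w :: "'a completion"
    using cut[of w] by simp
  show "x < y \<longleftrightarrow> x \<le> y \<and> \<not> y \<le> x" by (auto simp: rep)
  show "x \<le> x" by (simp add: rep)
  show "x \<le> y \<Longrightarrow> y \<le> z \<Longrightarrow> x \<le> z" by (auto simp: rep)
  show "x \<le> y \<Longrightarrow> y \<le> x \<Longrightarrow> x = y" by (simp add: rep flip: cut_inject)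
  show "inf x y \<le> x" by (simp add: rep)
  show "inf x y \<le> y" by (simp add: rep)
  show "x \<le> y \<Longrightarrow> x \<le> z \<Longrightarrow> x \<le> inf y z" by (simp add: rep)
  show "x \<le> sup x y"
    unfolding rep by (rule subset_trans[OF Un_upper1 lower_upper_extensive])
  show "y \<le> sup x y"
    unfolding rep by (rule subset_trans[OF Un_upper2 lower_upper_extensive])
  show "y \<le> x \<Longrightarrow> z \<le> x \<Longrightarrow> sup y z \<le> x"
    unfolding rep by (rule lower_upper_least[OF Un_least closed])
  show "x \<in> A \<Longrightarrow> Inf A \<le> x" unfolding rep by (rule INF_lower)
  show "(\<And>x. x \<in> A \<Longrightarrow> z \<le> x) \<Longrightarrow> z \<le> Inf A" unfolding rep by (rule INF_greatest)
  show "x \<in> A \<Longrightarrow> x \<le> Sup A"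
    unfolding rep by (rule subset_trans[OF UN_upper lower_upper_extensive])
  show "(\<And>x. x \<in> A \<Longrightarrow> x \<le> z) \<Longrightarrow> Sup A \<le> z"
    unfolding rep by (rule lower_upper_least[OF UN_least closed])
  show "Inf {} = (top :: 'a completion)" by (simp add: rep flip: cut_inject)
  show "Sup {} = (bot :: 'a completion)" by (simp add: rep flip: cut_inject)
qed

end

instantiation completion :: (boolean_algebra) boolean_algebra
begin

lift_definition uminus_completion :: "'a completion \<Rightarrow> 'a completion" is "disjoint_from"
  by (rule lower_upper_disjoint_from)
definition minus_completion :: "'a completion \<Rightarrow> 'a completion \<Rightarrow> 'a completion" where
  "minus_completion x y = inf x (- y)"

instance
proof
  fix x y z :: "'a completion"
  show "x - y = inf x (- y)" by (rule minus_completion_def)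
  show "inf x (- x) = bot"
  proof transfer
    fix A :: "'a set" assume "lower (upper A) = A"
    have "A \<inter> disjoint_from A \<subseteq> {bot}"
      unfolding disjoint_from_def by (auto dest!: bspec)
    moreover have "{bot :: 'a} \<subseteq> lower (upper {})"
      by (auto simp: lower_def)
    ultimately have "A \<inter> disjoint_from A \<subseteq> lower (upper {})"
      by blast
    moreover have "lower (upper {}) \<subseteq> A \<inter> disjoint_from A"
      using \<open>lower (upper A) = A\<close> lower_upper_disjoint_from[of A]
      by (metis empty_subsetI le_inf_iff lower_upper_least)
    ultimately show "A \<inter> disjoint_from A = lower (upper {})"
      by blast
  qed
  show "sup x (- x) = top"
  proof transfer
    fix A :: "'a set" assume "lower (upper A) = A"
    have bot: "y = bot" if "y \<in> disjoint_from (A \<union> disjoint_from A)" for y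
    proof -
      have "y \<in> disjoint_from A" "\<forall>a \<in> disjoint_from A. inf y a = bot"
        using that by (auto simp: disjoint_from_def)
      then show ?thesis
        by (metis inf.idem)
    qed
    have "x \<in> disjoint_from (disjoint_from (A \<union> disjoint_from A))" for x
      unfolding disjoint_from_def[of "disjoint_from _"] using bot by fastforce
    then show "lower (upper (A \<union> disjoint_from A)) = UNIV"
      unfolding lower_upper_eq by blast
  qed
  have distr: "inf a (sup b c) \<le> sup (inf a b) (inf a c)" for a b c :: "'a completion"
  proof transfer
    fix A B C :: "'a set"
    assume A: "lower (upper A) = A" and B: "lower (upper B) = B" and C: "lower (upper C) = C"
    have down: "inf u v \<in> D" if "lower (upper D) = D" "v \<in> D" for D :: "'a set" and u v
    proof -
      have "inf u v \<in> lower (upper D)"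
        using that(2) by (auto simp: lower_def upper_def intro: le_infI2)
      then show ?thesis using that(1) by simp
    qed
    show "A \<inter> lower (upper (B \<union> C)) \<subseteq> lower (upper (A \<inter> B \<union> A \<inter> C))"
    proof
      fix x assume x: "x \<in> A \<inter> lower (upper (B \<union> C))"
      have "inf x y = bot" if y: "y \<in> disjoint_from (A \<inter> B \<union> A \<inter> C)" for y
      proof -
        have "inf (inf x y) b = bot" if b: "b \<in> B \<union> C" for b
        proof -
          have "inf b x \<in> A" using down[OF A] x by blast
          moreover have "inf b x \<in> B \<union> C"
            using down[OF B, of b x] down[OF C, of b x] down[OF B, of b] down[OF C, of b] b
            by (metis UnE UnI1 UnI2 inf.commute)
          ultimately have "inf y (inf b x) = bot"
            using y by (auto simp: disjoint_from_def)
          then show ?thesis by (simp add: ac_simps)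
        qed
        then have "inf x y \<in> disjoint_from (B \<union> C)"
          by (simp add: disjoint_from_def)
        then have "inf x (inf x y) = bot"
          using x unfolding lower_upper_eq disjoint_from_def[of "disjoint_from _"] by blast
        then show ?thesis by simp
      qed
      then show "x \<in> lower (upper (A \<inter> B \<union> A \<inter> C))"
        unfolding lower_upper_eq by (simp add: disjoint_from_def[of "disjoint_from _"])
    qed
  qed
  then show "sup x (inf y z) = inf (sup x y) (sup x z)"
    by (intro distrib_imp1 antisym) (auto intro: le_infI1 le_infI2 le_supI1 le_supI2)
qed

end

lift_definition embed :: "'a::boolean_algebra \<Rightarrow> 'a completion" is "\<lambda>a. {x. x \<le> a}"
  by (auto simp: lower_def upper_def)

lemma embed_le_iff: "embed a \<le> embed b \<longleftrightarrow> a \<le> b"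
  by transfer auto

lemma embed_inf: "embed (inf a b) = inf (embed a) (embed b)"
  by transfer auto

lemma embed_uminus: "embed (- a) = - embed a"
proof -
  have "x \<le> - a \<longleftrightarrow> (\<forall>y\<in>{y. y \<le> a}. inf x y = bot)" for x
  proof
    assume x: "x \<le> - a"
    show "\<forall>y\<in>{y. y \<le> a}. inf x y = bot"
    proof
      fix y assume "y \<in> {y. y \<le> a}"
      then have "inf x y \<le> inf (- a) a" using x by (intro inf_mono) auto
      then show "inf x y = bot" by (simp add: bot_unique)
    qed
  next
    assume "\<forall>y\<in>{y. y \<le> a}. inf x y = bot"
    then have "inf x a = bot" by simp
    then show "x \<le> - a" by (simp add: inf_shunt)
  qed
  then have "cut (embed (- a)) = cut (- embed a)"
    unfolding embed.rep_eq uminus_completion.rep_eq disjoint_from_def by (intro Collect_cong)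
  then show ?thesis by (simp add: cut_inject)
qed

lemma embed_dense: "x = Sup {embed a | a. embed a \<le> x}"
proof (rule antisym)
  have below: "embed a \<le> x" if "a \<in> cut x" for a
  proof -
    have "{y. y \<le> a} \<subseteq> lower (upper (cut x))"
      using that by (auto simp: lower_def upper_def intro: order_trans)
    also have "lower (upper (cut x)) = cut x" using cut[of x] by simp
    finally show ?thesis by (simp add: less_eq_completion.rep_eq embed.rep_eq)
  qed
  have "cut x \<subseteq> cut (Sup {embed a | a. embed a \<le> x})"
  proof
    fix a assume "a \<in> cut x"
    then have "embed a \<le> Sup {embed a | a. embed a \<le> x}"
      using below by (intro Sup_upper) auto
    moreover have "a \<in> cut (embed a)" by (simp add: embed.rep_eq)
    ultimately show "a \<in> cut (Sup {embed a | a. embed a \<le> x})"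
      unfolding less_eq_completion.rep_eq by (rule subsetD)
  qed
  then show "x \<le> Sup {embed a | a. embed a \<le> x}"
    by (simp only: less_eq_completion.rep_eq)
qed (rule Sup_least, auto)


section \<open>Boolean algebras given by generators and relations\<close>

datatype 'g bterm =
    Gen 'g
  | Zero
  | One
  | Neg "'g bterm"
  | Meet "'g bterm" "'g bterm"
  | Join "'g bterm" "'g bterm"

text \<open>
  The least congruence containing the given equations \<open>R\<close> and the axioms of Boolean algebras.
\<close>

inductive bcong :: "('g bterm \<times> 'g bterm) set \<Rightarrow> 'g bterm \<Rightarrow> 'g bterm \<Rightarrow> bool"
  for R :: "('g bterm \<times> 'g bterm) set" where
  rel: "(s, t) \<in> R \<Longrightarrow> bcong R s t"
| refl: "bcong R s s"
| sym: "bcong R s t \<Longrightarrow> bcong R t s"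
| trans: "bcong R s t \<Longrightarrow> bcong R t u \<Longrightarrow> bcong R s u"
| Neg: "bcong R s s' \<Longrightarrow> bcong R (Neg s) (Neg s')"
| Meet: "bcong R s s' \<Longrightarrow> bcong R t t' \<Longrightarrow> bcong R (Meet s t) (Meet s' t')"
| Join: "bcong R s s' \<Longrightarrow> bcong R t t' \<Longrightarrow> bcong R (Join s t) (Join s' t')"
| Meet_comm: "bcong R (Meet s t) (Meet t s)"
| Join_comm: "bcong R (Join s t) (Join t s)"
| Meet_assoc: "bcong R (Meet (Meet s t) u) (Meet s (Meet t u))"
| Join_assoc: "bcong R (Join (Join s t) u) (Join s (Join t u))"
| Meet_absorb: "bcong R (Meet s (Join s t)) s"
| Join_absorb: "bcong R (Join s (Meet s t)) s"
| Join_Meet_distrib: "bcong R (Join s (Meet t u)) (Meet (Join s t) (Join s u))"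
| Join_Zero: "bcong R (Join s Zero) s"
| Meet_One: "bcong R (Meet s One) s"
| Meet_Neg: "bcong R (Meet s (Neg s)) Zero"
| Join_Neg: "bcong R (Join s (Neg s)) One"

lemma equivp_bcong: "equivp (bcong R)"
  by (rule equivpI) (auto simp: reflp_def symp_def transp_def intro: bcong.intros)


text \<open>
  The algebra generated by the elements of \<^typ>\<open>'g\<close> freely subject to given relations; the
  relations are attached to the type of generators by a type class, since a type cannot depend on
  a set of relations.
\<close>

class generators =
  fixes relations :: "('a bterm \<times> 'a bterm) set"

quotient_type (overloaded) 'g presented = "'g::generators bterm" / "bcong relations"
  by (rule equivp_bcong)

instantiation presented :: (generators) boolean_algebra
begin

lift_definition bot_presented :: "'a presented" is Zero .
lift_definition top_presented :: "'a presented" is One .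
lift_definition uminus_presented :: "'a presented \<Rightarrow> 'a presented" is Neg
  by (rule bcong.Neg)
lift_definition inf_presented :: "'a presented \<Rightarrow> 'a presented \<Rightarrow> 'a presented" is Meet
  by (rule bcong.Meet)
lift_definition sup_presented :: "'a presented \<Rightarrow> 'a presented \<Rightarrow> 'a presented" is Join
  by (rule bcong.Join)
definition minus_presented :: "'a presented \<Rightarrow> 'a presented \<Rightarrow> 'a presented" where
  "minus_presented x y = inf x (- y)"
definition less_eq_presented :: "'a presented \<Rightarrow> 'a presented \<Rightarrow> bool" where
  "less_eq_presented x y \<longleftrightarrow> inf x y = x"
definition less_presented :: "'a presented \<Rightarrow> 'a presented \<Rightarrow> bool" where
  "less_presented x y \<longleftrightarrow> inf x y = x \<and> x \<noteq> y"

instance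
proof -
  have comm: "inf x y = inf y x" "sup x y = sup y x" for x y :: "'a presented"
    by (transfer, rule bcong.Meet_comm, transfer, rule bcong.Join_comm)
  have assoc: "inf (inf x y) z = inf x (inf y z)" "sup (sup x y) z = sup x (sup y z)" for x y z :: "'a presented"
    by (transfer, rule bcong.Meet_assoc, transfer, rule bcong.Join_assoc)
  have absorb: "inf x (sup x y) = x" "sup x (inf x y) = x" for x y :: "'a presented"
    by (transfer, rule bcong.Meet_absorb, transfer, rule bcong.Join_absorb)
  have distrib: "sup x (inf y z) = inf (sup x y) (sup x z)" for x y z :: "'a presented"
    by (transfer, rule bcong.Join_Meet_distrib)
  have unit: "sup x bot = x" "inf x top = x" for x :: "'a presented"
    by (transfer, rule bcong.Join_Zero, transfer, rule bcong.Meet_One)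
  have compl: "inf x (- x) = bot" "sup x (- x) = top" for x :: "'a presented"
    by (transfer, rule bcong.Meet_Neg, transfer, rule bcong.Join_Neg)
  have idem: "inf x x = x" "sup x x = x" for x :: "'a presented"
    using absorb(1)[of x "inf x x"] absorb(2)[of x "sup x x"] absorb(1)[of x x] absorb(2)[of x x]
    by simp_all
  have inf_if: "sup x y = y \<Longrightarrow> inf x y = x" for x y :: "'a presented"
    using absorb(1)[of x y] by simp
  have sup_if: "inf x y = x \<Longrightarrow> sup x y = y" for x y :: "'a presented"
    using absorb(2)[of y x] comm by simp
  show "OFCLASS('a presented, boolean_algebra_class)"
  proof
    fix x y z :: "'a presented"
    note le = less_eq_presented_def
    have anti: "x = y" if "x \<le> y" "y \<le> x" for x y :: "'a presented"
      using that comm(1)[of x y] unfolding le by simp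
    show "x < y \<longleftrightarrow> x \<le> y \<and> \<not> y \<le> x"
      using anti[of x y] idem(1) unfolding le less_presented_def by auto
    show "x \<le> x" by (simp add: le idem)
    show "x \<le> z" if "x \<le> y" "y \<le> z"
    proof -
      have "inf x z = inf (inf x y) z" using that(1) by (simp add: le)
      also have "\<dots> = inf x (inf y z)" by (rule assoc)
      also have "\<dots> = x" using that by (simp add: le)
      finally show ?thesis by (simp add: le)
    qed
    show "x \<le> y \<Longrightarrow> y \<le> x \<Longrightarrow> x = y" by (rule anti)
    show "inf x y \<le> x"
      unfolding le comm(1)[of "inf x y" x] by (simp add: idem flip: assoc)
    show "inf x y \<le> y" unfolding le by (simp add: assoc idem)
    show "x \<le> inf y z" if "x \<le> y" "x \<le> z"
      using that unfolding le by (simp flip: assoc)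
    show "x \<le> sup x y" unfolding le by (rule absorb)
    show "y \<le> sup x y" unfolding le comm(2)[of x y] by (rule absorb)
    show "sup y z \<le> x" if "y \<le> x" "z \<le> x"
      using that sup_if[of y x] sup_if[of z x] unfolding le by (intro inf_if) (simp add: assoc)
    show "bot \<le> x" unfolding le using unit(1)[of x] comm(2)[of x bot] by (intro inf_if) simp
    show "x \<le> top" unfolding le by (rule unit)
    show "x - y = inf x (- y)" by (rule minus_presented_def)
    show "sup x (inf y z) = inf (sup x y) (sup x z)" by (rule distrib)
    show "inf x (- x) = bot" by (rule compl)
    show "sup x (- x) = top" by (rule compl)
  qed
qed

end

lift_definition presented_gen :: "'g::generators \<Rightarrow> 'g presented" is Gen .


section \<open>The algebra \<open>\<BB>\<^sup>1\<close>\<close>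

text \<open>
  \<open>'k\<close> is the set of coordinates \<open>\<beta>\<close> and \<open>'m\<close> has cardinality \<open>\<mu>\<close>, so that
  \<^typ>\<open>('k, 'm) fmap\<close> is the set of finite functions from a subset of \<open>\<beta>\<close> into \<open>\<mu>\<close>.
\<close>

definition compatible :: "('k, 'm) fmap \<Rightarrow> ('k, 'm) fmap \<Rightarrow> bool" where
  "compatible f g \<longleftrightarrow> (\<forall>k \<in> fmdom' f \<inter> fmdom' g. fmlookup f k = fmlookup g k)"

text \<open>
  The last two families of relations express that \<open>x\<^sub>f\<close> stands for the finite conjunction of
  the conditions \<open>f(k) = v\<close>: the empty function yields 1 and \<open>x\<^sub>f \<inter> x\<^sub>g = x\<^bsub>f \<union> g\<^esub>\<close> for compatible
  \<open>f\<close>, \<open>g\<close> (for which \<open>f ++\<^sub>f g\<close> is the union).  They are tacit in the usual description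
  by the first two families, and they are what makes the generators dense in the algebra.
  If only the first two families were imposed, the complement of \<open>x\<^sub>\<emptyset>\<close> would be an
  atom disjoint from all generators, no antichain of generators would be maximal, and so no
  sequence would have a support.
\<close>

definition fi_relations :: "(('k, 'm) fmap bterm \<times> ('k, 'm) fmap bterm) set" where
  "fi_relations =
     {(Meet (Gen f\<^sub>2) (Gen f\<^sub>1), Gen f\<^sub>2) | f\<^sub>1 f\<^sub>2. f\<^sub>1 \<subseteq>\<^sub>f f\<^sub>2}
   \<union> {(Meet (Gen f) (Gen g), Zero) | f g. \<not> compatible f g}
   \<union> {(Gen fmempty, One)}
   \<union> {(Meet (Gen f) (Gen g), Gen (f ++\<^sub>f g)) | f g. compatible f g}"

instantiation fmap :: (type, type) generators
begin
definition relations_fmap :: "(('a, 'b) fmap bterm \<times> ('a, 'b) fmap bterm) set" where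
  "relations_fmap = fi_relations"
instance ..
end

type_synonym ('k, 'm) B1 = "('k, 'm) fmap presented completion"

definition gen :: "('k, 'm) fmap \<Rightarrow> ('k, 'm) B1" where
  "gen f = embed (presented_gen f)"

definition complete_subalgebra :: "'b::{boolean_algebra, complete_lattice} set \<Rightarrow> bool" where
  "complete_subalgebra C \<longleftrightarrow>
     (\<forall>x\<in>C. - x \<in> C) \<and> (\<forall>S. S \<subseteq> C \<longrightarrow> Sup S \<in> C) \<and> (\<forall>S. S \<subseteq> C \<longrightarrow> Inf S \<in> C)"

definition generated_complete_subalgebra ::
    "'b::{boolean_algebra, complete_lattice} set \<Rightarrow> 'b set" where
  "generated_complete_subalgebra G = \<Inter>{C. complete_subalgebra C \<and> G \<subseteq> C}"

text \<open>\<open>\<BB>\<^sup>+\<^bsub>\<alpha>,\<mu>\<^esub>\<close>, for a set \<open>\<alpha>\<close> of coordinates.\<close>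

definition B1_plus :: "'k set \<Rightarrow> ('k, 'm) B1 set" where
  "B1_plus \<alpha> = generated_complete_subalgebra {gen f | f. fmdom' f \<subseteq> \<alpha>} - {bot}"


section \<open>Supports, ultrafilters and perfection\<close>

definition antichain :: "'b::boolean_algebra set \<Rightarrow> bool" where
  "antichain A \<longleftrightarrow> bot \<notin> A \<and> (\<forall>x\<in>A. \<forall>y\<in>A. x \<noteq> y \<longrightarrow> inf x y = bot)"

definition maximal_antichain :: "'b::boolean_algebra set \<Rightarrow> bool" where
  "maximal_antichain A \<longleftrightarrow> antichain A \<and> (\<forall>A'. antichain A' \<and> A \<subseteq> A' \<longrightarrow> A' = A)"

text \<open>
  The index set \<open>[\<lambda>]\<^bsup><\<aleph>\<^sub>0\<^esup>\<close> is \<^typ>\<open>'l fset\<close>, where \<open>'l\<close> is a type of cardinality \<open>\<lambda>\<close>.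
\<close>

definition support :: "('l fset \<Rightarrow> ('k, 'm) B1) \<Rightarrow> ('k, 'm) B1 set \<Rightarrow> bool" where
  "support b X \<longleftrightarrow> X \<subseteq> range gen \<and>
     (\<forall>u. \<exists>A. maximal_antichain A \<and> A \<subseteq> X \<and> (\<forall>x\<in>A. x \<le> b u \<or> x \<le> - b u))"

definition ultrafilter_on :: "'b::boolean_algebra set \<Rightarrow> bool" where
  "ultrafilter_on D \<longleftrightarrow> top \<in> D \<and> bot \<notin> D
     \<and> (\<forall>x\<in>D. \<forall>y\<in>D. inf x y \<in> D)
     \<and> (\<forall>x\<in>D. \<forall>y. x \<le> y \<longrightarrow> y \<in> D)
     \<and> (\<forall>x. x \<in> D \<or> - x \<in> D)"

definition multiplicative :: "('l fset \<Rightarrow> 'b::boolean_algebra) \<Rightarrow> bool" where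
  "multiplicative b \<longleftrightarrow> (\<forall>u v. inf (b u) (b v) = b (u |\<union>| v))"

text \<open>
  The coordinates are the ordinals below \<open>2\<^sup>\<lambda>\<close>: the elements of \<^typ>\<open>'l set\<close> in the cardinal
  well-order \<^term>\<open>|UNIV :: 'l set set|\<close>.  An ordinal \<open>\<alpha> < 2\<^sup>\<lambda>\<close> is identified with the set of
  its predecessors.
\<close>

definition below :: "'l set \<Rightarrow> 'l set set" where
  "below \<alpha> = underS |UNIV :: 'l set set| \<alpha>"

definition perfect_hypothesis ::
    "('l set, 'm) B1 set \<Rightarrow> ('l fset \<Rightarrow> ('l set, 'm) B1) \<Rightarrow> bool" where
  "perfect_hypothesis D b \<longleftrightarrow>
     range b \<subseteq> D \<and> antimono b \<and>
     (\<exists>X. support b X \<and> |X| \<le>o |UNIV :: 'l set| \<and>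
       (\<forall>\<alpha>. \<Union>{fmdom' f | f. gen f \<in> X} \<subseteq> below \<alpha> \<longrightarrow>
         (\<exists>b'. multiplicative b' \<and> (\<forall>u. b' u \<noteq> bot) \<and> (\<forall>u. b' u \<le> b u) \<and>
           (\<forall>c \<in> B1_plus (below \<alpha>) \<inter> D.
             \<forall>S. finite S \<and> S \<subseteq> {sup (b' {|i|}) (- b {|i|}) | i. True} \<longrightarrow>
               inf (Inf S) c \<noteq> bot))))"

definition perfect_ultrafilter :: "('l set, 'm) B1 set \<Rightarrow> bool" where
  "perfect_ultrafilter D \<longleftrightarrow> ultrafilter_on D \<and>
     (\<forall>b. perfect_hypothesis D b \<longrightarrow>
       (\<exists>b'. multiplicative b' \<and> range b' \<subseteq> D \<and> (\<forall>u. b' u \<le> b u)))"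

end

theory Submission
  imports Defs
begin

text \<open>
  The generators are dense in \<open>\<BB>\<close>, so an element is determined by the generators below it.
  An element depends only on a set \<open>Y\<close> of coordinates if this set of generators is closed under
  restriction to \<open>Y\<close>; every sequence indexed by \<open>[\<lambda>]\<^bsup><\<aleph>\<^sub>0\<^esup>\<close> depends on at most
  \<open>\<lambda>\<close> coordinates.

  All sequences having a support of size at most \<open>\<lambda>\<close> are enumerated in order type \<open>2\<^sup>\<lambda>\<close> such that
  each of them occurs at arbitrarily late stages.  At stage \<open>\<alpha>\<close> the filter built so far is made to
  decide all elements over the coordinates below \<open>\<alpha>\<close>.  If the sequence enumerated at \<open>\<alpha>\<close> has a
  multiplicative refinement meeting every member of the filter over these coordinates, such a
  refinement is added to the filter.  It may be taken over \<open>\<alpha>\<close> and a block \<open>W\<^sub>\<alpha>\<close> of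
  coordinates reserved for this stage, since its other coordinates can be moved by an automorphism
  fixing \<open>\<alpha>\<close>.  As the filter involves only \<open>\<alpha>\<close> and earlier blocks, amalgamation over
  \<open>\<alpha>\<close> shows that the finite intersection property is preserved.  Reserving blocks avoids any
  appeal to the regularity of \<open>2\<^sup>\<lambda>\<close>: the coordinates used so far need not be bounded.
\<close>

section \<open>Generators\<close>

lemma presented_gen_mono:
  "f \<subseteq>\<^sub>f g \<Longrightarrow> presented_gen g \<le> (presented_gen f :: ('k, 'm) fmap presented)"
  unfolding less_eq_presented_def
  by transfer (rule bcong.rel, auto simp: relations_fmap_def fi_relations_def)

lemma presented_gen_incompatible:
  "\<not> compatible f g \<Longrightarrow> inf (presented_gen f) (presented_gen g) = (bot :: ('k, 'm) fmap presented)"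
  by transfer (rule bcong.rel, auto simp: relations_fmap_def fi_relations_def)

lemma presented_gen_empty: "presented_gen fmempty = (top :: ('k, 'm) fmap presented)"
  by transfer (rule bcong.rel, auto simp: relations_fmap_def fi_relations_def)

lemma presented_gen_inf:
  "compatible f g \<Longrightarrow>
    inf (presented_gen f) (presented_gen g) = (presented_gen (f ++\<^sub>f g) :: ('k, 'm) fmap presented)"
  by transfer (rule bcong.rel, auto simp: relations_fmap_def fi_relations_def)

text \<open>A model in the power set of the total functions: a condition becomes the cylinder of its
  total extensions. It serves to show that no generator collapses to zero.\<close>

primrec interp :: "('k, 'm) fmap bterm \<Rightarrow> ('k \<Rightarrow> 'm) set" where
  "interp (Gen f) = {F. \<forall>k v. fmlookup f k = Some v \<longrightarrow> F k = v}"
| "interp Zero = {}"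
| "interp One = UNIV"
| "interp (Neg s) = - interp s"
| "interp (Meet s t) = interp s \<inter> interp t"
| "interp (Join s t) = interp s \<union> interp t"

section \<open>Inclusion and compatibility of conditions\<close>

lemma fmsubsetD: "f \<subseteq>\<^sub>f g \<Longrightarrow> fmlookup f k = Some v \<Longrightarrow> fmlookup g k = Some v"
  by (auto simp: fmsubset_alt_def fmpred_iff)

lemma fmsubsetI: "(\<And>k v. fmlookup f k = Some v \<Longrightarrow> fmlookup g k = Some v) \<Longrightarrow> f \<subseteq>\<^sub>f g"
  by (auto simp: fmsubset_alt_def fmpred_iff)

lemma compatible_iff:
  "compatible f g \<longleftrightarrow> (\<forall>k v w. fmlookup f k = Some v \<longrightarrow> fmlookup g k = Some w \<longrightarrow> v = w)"
  unfolding compatible_def Ball_def Int_iff fmlookup_dom'_iff by force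

lemma compatibleD: "compatible f g \<Longrightarrow> fmlookup f k = Some v \<Longrightarrow> fmlookup g k = Some w \<Longrightarrow> v = w"
  by (simp add: compatible_iff)

lemma compatible_sym: "compatible f g \<Longrightarrow> compatible g f"
  by (metis compatible_iff)

lemma fmlookup_add_compatible:
  "compatible f g \<Longrightarrow>
    fmlookup (f ++\<^sub>f g) k = Some v \<longleftrightarrow> fmlookup f k = Some v \<or> fmlookup g k = Some v"
  by (auto simp: compatible_iff fmlookup_dom_iff)

lemma interp_fi_relations: "(s, t) \<in> fi_relations \<Longrightarrow> interp s = interp t"
  unfolding fi_relations_def
  by (auto simp: fmlookup_add_compatible simp del: fmlookup_add dest: fmsubsetD)
    (auto simp: compatible_iff dest: fmsubsetD)

lemma interp_bcong: "bcong relations s t \<Longrightarrow> interp s = interp t"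
  by (induction rule: bcong.induct) (auto simp: relations_fmap_def dest: interp_fi_relations)

lemma presented_gen_nonbot: "presented_gen f \<noteq> (bot :: ('k, 'm) fmap presented)"
proof
  assume "presented_gen f = (bot :: ('k, 'm) fmap presented)"
  then have "bcong relations (Gen f) Zero"
    by transfer
  \<comment> \<open>Outside the domain of \<open>f\<close>, \<open>the\<close> yields an unspecified
    value, so this is some total function in the cylinder of \<open>f\<close>.\<close>
  from interp_bcong[OF this] have "(\<lambda>k. the (fmlookup f k)) \<notin> interp (Gen f)"
    by (simp only: interp.simps empty_iff not_False_eq_True)
  then show False by simp
qed

section \<open>Density of the generators in the presented algebra\<close>

lemma decide_finite:
  fixes x :: "'b::boolean_algebra"
  assumes "finite G" "x \<noteq> bot"
  shows "\<exists>y\<le>x. y \<noteq> bot \<and> (\<forall>g\<in>G. y \<le> g \<or> y \<le> - g)"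
  using assms
proof (induction G)
  case (insert g G)
  then obtain y where y: "y \<le> x" "y \<noteq> bot" "\<forall>g\<in>G. y \<le> g \<or> y \<le> - g" by auto
  show ?case
  \<comment> \<open>If \<open>y\<close> misses \<open>g\<close> it already lies below the
    complement; otherwise it is cut down to \<open>g\<close>, which preserves the earlier
    decisions.\<close>
  proof (cases "inf y g = bot")
    case True
    then have "y \<le> - g" by (simp add: inf_shunt)
    then show ?thesis using y by auto
  next
    case False
    have "\<forall>h\<in>insert g G. inf y g \<le> h \<or> inf y g \<le> - h"
      using y(3) by (auto intro: le_infI1 le_infI2)
    moreover have "inf y g \<le> x" using y(1) by (rule le_infI1)
    ultimately show ?thesis using False by blast
  qed
qed auto

primrec gens_of :: "'g bterm \<Rightarrow> 'g set" where
  "gens_of (Gen f) = {f}"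
| "gens_of Zero = {}"
| "gens_of One = {}"
| "gens_of (Neg s) = gens_of s"
| "gens_of (Meet s t) = gens_of s \<union> gens_of t"
| "gens_of (Join s t) = gens_of s \<union> gens_of t"

lemma finite_gens_of: "finite (gens_of t)"
  by (induction t) auto

lemma abs_presented_simps:
  "abs_presented (Gen f) = presented_gen f"
  "abs_presented Zero = bot" "abs_presented One = top"
  "abs_presented (Neg s) = - abs_presented s"
  "abs_presented (Meet s t) = inf (abs_presented s) (abs_presented t)"
  "abs_presented (Join s t) = sup (abs_presented s) (abs_presented t)"
  by (simp_all add: presented_gen.abs_eq bot_presented.abs_eq top_presented.abs_eq
      uminus_presented.abs_eq inf_presented.abs_eq sup_presented.abs_eq)

lemma decided_by_gens:
  assumes "\<forall>f\<in>gens_of t. e \<le> presented_gen f \<or> e \<le> - presented_gen f"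
  shows "e \<le> abs_presented t \<or> e \<le> - abs_presented t"
  using assms
  by (induction t) (auto simp: abs_presented_simps intro: le_infI1 le_infI2 le_supI1 le_supI2)

text \<open>Conditions whose generators lie above a nonzero \<open>y\<close> are compatible, so they
  can be merged one after another while staying above \<open>y\<close>.\<close>

lemma Gen_finite_meet:
  fixes y :: "('k, 'm) fmap presented"
  assumes "finite P" "y \<noteq> bot" "\<forall>f\<in>P. y \<le> presented_gen f"
  shows "\<exists>f. y \<le> presented_gen f \<and> (\<forall>g\<in>P. g \<subseteq>\<^sub>f f)"
  using assms
proof (induction P)
  case empty
  show ?case by (rule exI[of _ fmempty]) (simp add: presented_gen_empty)
next
  case (insert g P)
  then obtain f where f: "y \<le> presented_gen f" "\<forall>g\<in>P. g \<subseteq>\<^sub>f f" by auto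
  have y: "y \<le> inf (presented_gen g) (presented_gen f)" using insert f by auto
  then have c: "compatible g f"
    using presented_gen_incompatible[of g f] insert.prems(1) bot.extremum_unique by metis
  have sub: "g \<subseteq>\<^sub>f g ++\<^sub>f f" "f \<subseteq>\<^sub>f g ++\<^sub>f f"
    using c by (auto intro!: fmsubsetI simp: fmlookup_add_compatible simp del: fmlookup_add)
  have "y \<le> presented_gen (g ++\<^sub>f f)" using y by (simp add: presented_gen_inf[OF c])
  moreover have "\<forall>h\<in>insert g P. h \<subseteq>\<^sub>f g ++\<^sub>f f"
    using sub f(2) by (auto intro!: fmsubsetI dest: fmsubsetD)
  ultimately show ?case by blast
qed

text \<open>Finitely many conditions use finitely many values, so a fresh value \<open>v\<close>
  exists. Putting \<open>v\<close> at every coordinate of \<open>N\<close> left free by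
  \<open>f\<close> contradicts each \<open>g\<close> in \<open>N\<close> that is not part of
  \<open>f\<close>.\<close>

lemma avoid_finite:
  fixes f :: "('k, 'm) fmap"
  assumes "infinite (UNIV :: 'm set)" "finite N" "\<forall>g\<in>N. \<not> g \<subseteq>\<^sub>f f"
  shows "\<exists>f'. f \<subseteq>\<^sub>f f' \<and> (\<forall>g\<in>N. \<not> compatible f' g)"
proof -
  have "finite (\<Union>g\<in>N. fmran' g)" using assms(2) by (simp add: fmran'_alt_def)
  then obtain v where v: "v \<notin> (\<Union>g\<in>N. fmran' g)"
    using assms(1) ex_new_if_finite by blast
  have fin: "finite (\<Union>g\<in>N. fmdom' g)" using assms(2) by simp
  define e where "e = fmap_of_list (map (\<lambda>k. (k, v)) (SOME ks. set ks = (\<Union>g\<in>N. fmdom' g)))"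
  have ks: "set (SOME ks. set ks = (\<Union>g\<in>N. fmdom' g)) = (\<Union>g\<in>N. fmdom' g)"
    using finite_list[OF fin] by (rule someI_ex)
  have e: "fmlookup e k = (if k \<in> (\<Union>g\<in>N. fmdom' g) then Some v else None)" for k
    unfolding e_def fmlookup_of_list map_of_map_restrict ks by (simp add: restrict_map_def)
  \<comment> \<open>The right argument takes precedence, so the values of \<open>f\<close>
    survive.\<close>
  define f' where "f' = e ++\<^sub>f f"
  have lk: "fmlookup f' k = (case fmlookup f k of Some w \<Rightarrow> Some w | None \<Rightarrow> fmlookup e k)" for k
    unfolding f'_def by (auto split: option.split dest: fmdomI)
  have "f \<subseteq>\<^sub>f f'" by (rule fmsubsetI) (simp add: lk)
  moreover have "\<not> compatible f' g" if g: "g \<in> N" for g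
  proof
    assume c: "compatible f' g"
    have "g \<subseteq>\<^sub>f f"
    proof (rule fmsubsetI)
      fix k w assume w: "fmlookup g k = Some w"
      then have "w \<noteq> v" using v g by (auto intro: fmran'I)
      have "fmlookup e k = Some v" using w g by (auto simp: e intro: fmdom'I)
      show "fmlookup f k = Some w"
      proof (cases "fmlookup f k")
        case None
        then have "fmlookup f' k = Some v" by (simp add: lk \<open>fmlookup e k = Some v\<close>)
        then have "v = w" by (rule compatibleD[OF c _ w])
        then show ?thesis using \<open>w \<noteq> v\<close> by simp
      next
        case (Some w')
        then have "fmlookup f' k = Some w'" by (simp add: lk)
        then have "w' = w" by (rule compatibleD[OF c _ w])
        then show ?thesis using Some by simp
      qed
    qed
    then show False using assms(3) g by blast
  qed
  ultimately show ?thesis by blast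
qed

text \<open>Let a nonzero \<open>y\<close> below \<open>x\<close> decide all generators of a term
  for \<open>x\<close>. Those above \<open>y\<close> are merged into \<open>f\<close>, and
  \<open>f\<close> is extended to contradict the others. The resulting \<open>f'\<close> decides
  like \<open>y\<close>, hence also lies below \<open>x\<close>.\<close>

lemma presented_gen_dense:
  fixes x :: "('k, 'm) fmap presented"
  assumes "infinite (UNIV :: 'm set)" "x \<noteq> bot"
  shows "\<exists>f. presented_gen f \<le> x"
proof -
  obtain t where t: "x = abs_presented t" by (induction x rule: presented.abs_induct) auto
  let ?G = "gens_of t"
  from decide_finite[of "presented_gen ` ?G", OF finite_imageI[OF finite_gens_of] assms(2)]
  obtain y where y: "y \<le> x" "y \<noteq> bot" "\<forall>f\<in>?G. y \<le> presented_gen f \<or> y \<le> - presented_gen f"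
    by auto
  define P where "P = {f \<in> ?G. y \<le> presented_gen f}"
  have "finite P" "\<forall>f\<in>P. y \<le> presented_gen f" by (simp_all add: P_def finite_gens_of)
  from Gen_finite_meet[OF this(1) y(2) this(2)]
  obtain f where f: "y \<le> presented_gen f" "\<forall>g\<in>P. g \<subseteq>\<^sub>f f" by blast
  have "\<not> g \<subseteq>\<^sub>f f" if "g \<in> ?G - P" for g
  proof
    assume "g \<subseteq>\<^sub>f f"
    then have "y \<le> presented_gen g" using f(1) presented_gen_mono order_trans by blast
    then show False using that by (simp add: P_def)
  qed
  then obtain f' where f': "f \<subseteq>\<^sub>f f'" "\<forall>g\<in>?G - P. \<not> compatible f' g"
    using avoid_finite[OF assms(1), of "?G - P" f] finite_gens_of by auto
  have dec: "presented_gen f' \<le> presented_gen g \<and> y \<le> presented_gen g \<or>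
      presented_gen f' \<le> - presented_gen g \<and> y \<le> - presented_gen g" if "g \<in> ?G" for g
  proof (cases "g \<in> P")
    case True
    then have "g \<subseteq>\<^sub>f f'" using f f' by (auto intro!: fmsubsetI dest: fmsubsetD)
    then show ?thesis using True by (simp add: P_def presented_gen_mono)
  next
    case False
    then have "presented_gen f' \<le> - presented_gen g"
      using f' that presented_gen_incompatible[of f' g] by (simp add: inf_shunt)
    then show ?thesis using False y(3) that by (auto simp: P_def)
  qed
  \<comment> \<open>The join decides every generator of \<open>t\<close> and hence \<open>x\<close>;
    its part \<open>y\<close> rules out the negative answer.\<close>
  define e where "e = sup y (presented_gen f')"
  have "e \<le> x \<or> e \<le> - x"
    unfolding t using dec by (intro decided_by_gens) (auto simp: e_def)
  moreover have "\<not> e \<le> - x"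
  proof
    assume "e \<le> - x"
    then have "y \<le> - x" by (simp add: e_def)
    then have "y \<le> inf x (- x)" using y(1) by (simp only: le_inf_iff)
    then show False using y(2) by (simp add: bot.extremum_unique)
  qed
  ultimately have "presented_gen f' \<le> x" by (auto simp: e_def)
  then show ?thesis ..
qed

subsection \<open>Generators of the completion\<close>

lemma embed_bot: "embed (bot :: 'a::boolean_algebra) = bot"
  using embed_inf[of "bot :: 'a" "- bot"] embed_uminus[of "bot :: 'a"] by simp

lemma gen_mono: "f \<subseteq>\<^sub>f g \<Longrightarrow> gen g \<le> gen f"
  by (simp add: gen_def embed_le_iff presented_gen_mono)

lemma gen_nonbot [simp]: "gen f \<noteq> bot"
  unfolding gen_def embed_bot[symmetric] using presented_gen_nonbot[of f]
  by (metis embed_le_iff bot.extremum_unique order_refl)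

lemma inf_gen_gen: "compatible f g \<Longrightarrow> inf (gen f) (gen g) = gen (f ++\<^sub>f g)"
  by (simp add: gen_def presented_gen_inf flip: embed_inf)

lemma inf_gen_eq_bot_iff: "inf (gen f) (gen g) = bot \<longleftrightarrow> \<not> compatible f g"
proof
  assume "\<not> compatible f g"
  then show "inf (gen f) (gen g) = bot"
    by (simp add: gen_def presented_gen_incompatible embed_bot flip: embed_inf)
next
  assume "inf (gen f) (gen g) = bot"
  then show "\<not> compatible f g" by (metis inf_gen_gen gen_nonbot)
qed

lemma B1_bot_neq_top: "(bot :: ('k, 'm) B1) \<noteq> top"
  by (metis gen_nonbot bot.extremum_unique top_greatest)

lemma gen_dense:
  fixes x :: "('k, 'm) B1"
  assumes inf: "infinite (UNIV :: 'm set)" and "x \<noteq> bot"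
  shows "\<exists>f. gen f \<le> x"
proof -
  have "\<exists>a. embed a \<le> x \<and> a \<noteq> bot"
  proof (rule ccontr)
    assume "\<not> ?thesis"
    then have "{embed a | a. embed a \<le> x} \<subseteq> {bot}" using embed_bot by auto
    from Sup_subset_mono[OF this] have "x \<le> bot" by (simp flip: embed_dense)
    then show False using assms(2) by (simp add: bot.extremum_unique)
  qed
  then obtain a where "embed a \<le> x" "a \<noteq> bot" by blast
  moreover obtain f where "presented_gen f \<le> a"
    using presented_gen_dense[OF inf \<open>a \<noteq> bot\<close>] by blast
  ultimately show ?thesis unfolding gen_def by (metis embed_le_iff order_trans)
qed

section \<open>Supports as sets of coordinates\<close>

text \<open>Members disjoint from \<open>s\<close> lie below \<open>- s\<close>, and then so does
  their supremum.\<close>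

lemma inf_Sup_neq_bot:
  fixes s :: "'b::{boolean_algebra, complete_lattice}"
  assumes "inf s (Sup A) \<noteq> bot"
  shows "\<exists>a\<in>A. inf s a \<noteq> bot"
proof (rule ccontr)
  assume "\<not> ?thesis"
  then have "\<forall>a\<in>A. a \<le> - s" by (auto simp: inf_shunt[symmetric] inf.commute)
  then have "Sup A \<le> - s" by (simp add: Sup_least)
  then show False using assms by (simp add: inf_shunt[symmetric] inf.commute)
qed

text \<open>A combinatorial substitute for membership in the complete subalgebra over
  \<open>Y\<close>; the link is \<open>supported_in_B1_plus\<close>.\<close>

definition supported :: "('k, 'm) B1 \<Rightarrow> 'k set \<Rightarrow> bool" where
  "supported x Y \<longleftrightarrow> (\<forall>f. gen f \<le> x \<longrightarrow> gen (fmrestrict_set Y f) \<le> x)"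

lemma supportedD: "supported x Y \<Longrightarrow> gen f \<le> x \<Longrightarrow> gen (fmrestrict_set Y f) \<le> x"
  by (simp add: supported_def)

lemma fmrestrict_set_subset: "Y \<subseteq> Y' \<Longrightarrow> fmrestrict_set Y f \<subseteq>\<^sub>f fmrestrict_set Y' f"
  by (rule fmsubsetI) (auto split: if_splits)

lemma supported_mono: "supported x Y \<Longrightarrow> Y \<subseteq> Y' \<Longrightarrow> supported x Y'"
  unfolding supported_def
  by (blast intro: order_trans[OF gen_mono] fmrestrict_set_subset)

lemma supported_Inf: "(\<And>x. x \<in> A \<Longrightarrow> supported x Y) \<Longrightarrow> supported (Inf A) Y"
  by (auto simp: supported_def le_Inf_iff)

lemma compatible_gen_le:
  assumes "gen g \<le> gen f"
  shows "compatible g f"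
  using assms inf_gen_eq_bot_iff[of g f] by (metis gen_nonbot inf.absorb1)

text \<open>Both sides express agreement on the common coordinates in \<open>Y\<close>, so a
  restriction can be moved across compatibility.\<close>

lemma compatible_restrict_swap:
  "compatible (fmrestrict_set Y f) g \<longleftrightarrow> compatible f (fmrestrict_set Y g)"
  by (auto simp: compatible_iff)

lemma compatible_le_disjoint:
  assumes "compatible f g" "gen f \<le> x" "gen g \<le> - x"
  shows False
proof -
  have "inf (gen f) (gen g) \<le> inf x (- x)" using assms(2,3) by (rule inf_mono)
  then show False using assms(1) inf_gen_eq_bot_iff[of f g] by (simp add: bot.extremum_unique)
qed

text \<open>If \<open>f\<close> is not part of \<open>g\<close>, some extension of \<open>g\<close>
  contradicts \<open>f\<close>. Injectivity later bounds the number of conditions by the size of a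
  support.\<close>

lemma gen_inj:
  fixes f g :: "('k, 'm) fmap"
  assumes inf: "infinite (UNIV :: 'm set)" and "gen f = gen g"
  shows "f = g"
proof -
  have sub: "f \<subseteq>\<^sub>f g" if "gen g \<le> gen f" for f g :: "('k, 'm) fmap"
  proof (rule ccontr)
    assume "\<not> f \<subseteq>\<^sub>f g"
    then obtain g' where g': "g \<subseteq>\<^sub>f g'" "\<not> compatible g' f"
      using avoid_finite[OF inf, of "{f}" g] by auto
    then have "gen g' \<le> gen f" using that gen_mono order_trans by blast
    then show False using compatible_gen_le g'(2) by blast
  qed
  have "f \<subseteq>\<^sub>f g" "g \<subseteq>\<^sub>f f" using sub assms(2) by auto
  then show ?thesis
    by (intro fmap_ext) (metis fmsubsetD not_Some_eq)
qed

context
  assumes infinite_values: "infinite (UNIV :: 'm set)"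
begin

lemma gen_below_inf:
  fixes x y :: "('k, 'm) B1"
  assumes "inf x y \<noteq> bot"
  shows "\<exists>f. gen f \<le> x \<and> gen f \<le> y"
  using gen_dense[OF infinite_values assms] by (simp add: le_inf_iff)

lemma not_le_gen:
  fixes x y :: "('k, 'm) B1"
  assumes "\<not> x \<le> y"
  shows "\<exists>f. gen f \<le> x \<and> gen f \<le> - y"
  using assms by (intro gen_below_inf) (simp add: inf_shunt)

lemma le_iff_gens:
  fixes x y :: "('k, 'm) B1"
  shows "x \<le> y \<longleftrightarrow> (\<forall>f. gen f \<le> x \<longrightarrow> gen f \<le> y)"
proof
  assume r: "\<forall>f. gen f \<le> x \<longrightarrow> gen f \<le> y"
  show "x \<le> y"
  proof (rule ccontr)
    assume "\<not> x \<le> y"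
    then obtain f where "gen f \<le> x" "gen f \<le> - y" using not_le_gen by blast
    then show False using r compatible_le_disjoint[of f f y] by (simp add: compatible_def)
  qed
qed (auto intro: order_trans)

text \<open>If the restriction of \<open>f\<close> is not below \<open>- x\<close>, some
  \<open>g\<close> below it is below \<open>x\<close>. The restriction of \<open>g\<close> remains
  below \<open>x\<close> but is compatible with \<open>f\<close>.\<close>

lemma supported_uminus:
  fixes x :: "('k, 'm) B1"
  assumes "supported x Y"
  shows "supported (- x) Y"
  unfolding supported_def
proof (intro allI impI, rule ccontr)
  fix f assume f: "gen f \<le> - x" and "\<not> gen (fmrestrict_set Y f) \<le> - x"
  then obtain g where g: "gen g \<le> gen (fmrestrict_set Y f)" "gen g \<le> x"
    using not_le_gen[of "gen (fmrestrict_set Y f)" "- x"] by auto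
  have "compatible (fmrestrict_set Y g) f"
    using compatible_gen_le[OF g(1)] by (simp add: compatible_restrict_swap)
  then show False
    using compatible_le_disjoint[OF _ supportedD[OF assms g(2)] f] by blast
qed

text \<open>A condition below a join need not lie below a member, so the complement is treated
  first: being incompatible with every \<open>s\<close> over \<open>Y\<close> depends only on the
  restriction to \<open>Y\<close>.\<close>

lemma supported_Sup_gen:
  fixes S :: "('k, 'm) fmap set"
  assumes "\<And>s. s \<in> S \<Longrightarrow> fmdom' s \<subseteq> Y"
  shows "supported (Sup (gen ` S)) Y"
proof -
  have restrict: "fmrestrict_set Y s = s" if "s \<in> S" for s
    using assms[OF that] by (metis fmrestrict_set_dom fmrestrict_set_twice inf.absorb_iff2)
  have "supported (- Sup (gen ` S)) Y"
    unfolding supported_def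
  proof (intro allI impI)
    fix f assume f: "gen f \<le> - Sup (gen ` S)"
    have "inf (gen (fmrestrict_set Y f)) (gen s) = bot" if s: "s \<in> S" for s
    proof -
      have "gen s \<le> Sup (gen ` S)" using s by (simp add: Sup_upper)
      then have "\<not> compatible f s" using f compatible_le_disjoint compatible_sym by blast
      then show ?thesis
        unfolding inf_gen_eq_bot_iff compatible_restrict_swap restrict[OF s] .
    qed
    then have "inf (gen (fmrestrict_set Y f)) (Sup (gen ` S)) = bot"
      using inf_Sup_neq_bot[of "gen (fmrestrict_set Y f)" "gen ` S"] by blast
    then show "gen (fmrestrict_set Y f) \<le> - Sup (gen ` S)" by (simp add: inf_shunt)
  qed
  then show ?thesis using supported_uminus by fastforce
qed

lemma supported_eq_Sup:
  fixes x :: "('k, 'm) B1"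
  assumes "supported x Y"
  shows "x = Sup (gen ` {f. gen f \<le> x \<and> fmdom' f \<subseteq> Y})"
proof (rule antisym)
  show "x \<le> Sup (gen ` {f. gen f \<le> x \<and> fmdom' f \<subseteq> Y})"
    unfolding le_iff_gens[of x]
  proof (intro allI impI)
    fix f assume f: "gen f \<le> x"
    have "gen f \<le> gen (fmrestrict_set Y f)" by (rule gen_mono) simp
    also have "\<dots> \<le> Sup (gen ` {f. gen f \<le> x \<and> fmdom' f \<subseteq> Y})"
      using supportedD[OF assms f] by (intro Sup_upper imageI) (simp add: fmdom'_restrict_set)
    finally show "gen f \<le> Sup (gen ` {f. gen f \<le> x \<and> fmdom' f \<subseteq> Y})" .
  qed
qed (auto intro: Sup_least)

lemma supported_in_B1_plus:
  fixes x :: "('k, 'm) B1"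
  assumes "supported x Y" "x \<noteq> bot"
  shows "x \<in> B1_plus Y"
proof -
  have "Sup (gen ` {f. gen f \<le> x \<and> fmdom' f \<subseteq> Y}) \<in> C"
    if C: "complete_subalgebra C" "{gen f | f. fmdom' f \<subseteq> Y} \<subseteq> C" for C
  proof -
    have "gen ` {f. gen f \<le> x \<and> fmdom' f \<subseteq> Y} \<subseteq> C" using C(2) by blast
    then show ?thesis using C(1) by (simp add: complete_subalgebra_def)
  qed
  then have "x \<in> C" if "complete_subalgebra C" "{gen f | f. fmdom' f \<subseteq> Y} \<subseteq> C" for C
    using that supported_eq_Sup[OF assms(1)] by simp
  then show ?thesis
    using assms(2) by (auto simp: B1_plus_def generated_complete_subalgebra_def)
qed

text \<open>Amalgamation over \<open>Y\<close>, with \<open>d\<close> the projection of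
  \<open>c\<close> to \<open>Y\<close>. If \<open>p\<close> below \<open>s\<close> were compatible
  with the projection of some \<open>q\<close> below \<open>c\<close>, the restrictions of
  \<open>p\<close> and \<open>q\<close> to the two supports would be compatible, as these supports
  meet only in \<open>Y\<close>.\<close>

lemma interpolation:
  fixes s c :: "('k, 'm) B1"
  assumes s: "supported s (Y \<union> W)" and c: "supported c (Y \<union> Z)"
    and WZ: "W \<inter> Z \<subseteq> Y" and "inf s c = bot"
  shows "\<exists>d. supported d Y \<and> c \<le> d \<and> inf s d = bot"
proof -
  define d where "d = Sup (gen ` fmrestrict_set Y ` {q. gen q \<le> c})"
  have "supported d Y"
    unfolding d_def by (rule supported_Sup_gen) (auto simp: fmdom'_restrict_set_precise)
  moreover have "c \<le> d"
    unfolding le_iff_gens[of c]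
  proof (intro allI impI)
    fix q assume "gen q \<le> c"
    have "gen q \<le> gen (fmrestrict_set Y q)" by (rule gen_mono) simp
    also have "\<dots> \<le> d" unfolding d_def using \<open>gen q \<le> c\<close> by (intro Sup_upper) auto
    finally show "gen q \<le> d" .
  qed
  moreover have "inf s d = bot"
  proof (rule ccontr)
    assume "inf s d \<noteq> bot"
    then obtain q where q: "gen q \<le> c" "inf s (gen (fmrestrict_set Y q)) \<noteq> bot"
      unfolding d_def using inf_Sup_neq_bot by blast
    then obtain p where p: "gen p \<le> s" "gen p \<le> gen (fmrestrict_set Y q)"
      using gen_below_inf by blast
    have "compatible (fmrestrict_set (Y \<union> W) p) (fmrestrict_set (Y \<union> Z) q)"
      using compatible_gen_le[OF p(2)] WZ unfolding compatible_iff
      by (auto split: if_splits)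
    then have "inf (gen (fmrestrict_set (Y \<union> W) p)) (gen (fmrestrict_set (Y \<union> Z) q)) \<noteq> bot"
      by (simp add: inf_gen_eq_bot_iff)
    moreover have "inf (gen (fmrestrict_set (Y \<union> W) p)) (gen (fmrestrict_set (Y \<union> Z) q)) \<le> inf s c"
      by (intro inf_mono supportedD[OF s] supportedD[OF c] p q)
    ultimately show False using assms(4) by (simp add: bot.extremum_unique)
  qed
  ultimately show ?thesis by blast
qed

end

section \<open>Renaming coordinates\<close>

context
  includes fmap.lifting
begin

text \<open>Injectivity keeps the domain of the composition finite; the empty map is the default
  otherwise. For an involution, precomposition also moves domains forward along
  \<open>p\<close>.\<close>

lift_definition fmrename :: "('k \<Rightarrow> 'k) \<Rightarrow> ('k, 'm) fmap \<Rightarrow> ('k, 'm) fmap"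
  is "\<lambda>p m. if inj p then m \<circ> p else Map.empty"
proof -
  fix p :: "'k \<Rightarrow> 'k" and m :: "'k \<rightharpoonup> 'm"
  assume "finite (dom m)"
  moreover have "dom (m \<circ> p) = p -` dom m" by auto
  ultimately show "finite (dom (if inj p then m \<circ> p else Map.empty))"
    by (auto intro: finite_vimageI)
qed

lemma fmlookup_rename: "inj p \<Longrightarrow> fmlookup (fmrename p f) k = fmlookup f (p k)"
  by transfer simp

end

text \<open>For an involution \<open>p\<close> this is the induced automorphism, extended from
  generators by joins.\<close>

definition B1_rename :: "('k \<Rightarrow> 'k) \<Rightarrow> ('k, 'm) B1 \<Rightarrow> ('k, 'm) B1" where
  "B1_rename p x = Sup (gen ` fmrename p ` {f. gen f \<le> x})"

lemma B1_rename_mono: "x \<le> y \<Longrightarrow> B1_rename p x \<le> B1_rename p y"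
  unfolding B1_rename_def by (intro Sup_subset_mono image_mono) (auto intro: order_trans)

lemma gen_rename_le: "gen f \<le> x \<Longrightarrow> gen (fmrename p f) \<le> B1_rename p x"
  unfolding B1_rename_def by (intro Sup_upper) auto

lemma B1_rename_bot: "B1_rename p (bot :: ('k, 'm) B1) = bot"
  unfolding B1_rename_def by (simp add: bot.extremum_unique)

context
  fixes p :: "'k \<Rightarrow> 'k"
  assumes involution: "\<And>k. p (p k) = k"
begin

private lemma inj_p: "inj p"
  using involution by (metis injI)

lemma fmrename_fmrename: "fmrename p (fmrename p f) = f"
  by (rule fmap_ext) (simp add: fmlookup_rename[OF inj_p] involution)

lemma compatible_fmrename: "compatible (fmrename p f) g \<longleftrightarrow> compatible f (fmrename p g)"
  unfolding compatible_iff fmlookup_rename[OF inj_p] by (metis involution)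

context
  assumes infinite_values: "infinite (UNIV :: 'm set)"
begin

text \<open>The defining join acquires no unexpected generators. Otherwise some \<open>g\<close>
  below the renamed \<open>f\<close> lies below \<open>- x\<close>; renamed back, it is compatible
  with \<open>f\<close> and so with some renamed \<open>s\<close> where
  \<open>gen s \<le> x\<close>. Then \<open>g\<close> and \<open>s\<close> are compatible, a
  contradiction.\<close>

lemma gen_le_renameD:
  fixes x :: "('k, 'm) B1"
  assumes "gen f \<le> B1_rename p x"
  shows "gen (fmrename p f) \<le> x"
proof (rule ccontr)
  assume "\<not> ?thesis"
  then obtain g where g: "gen g \<le> gen (fmrename p f)" "gen g \<le> - x"
    using not_le_gen[OF infinite_values] by blast
  have "compatible (fmrename p g) f"
    using compatible_gen_le[OF g(1)] by (simp add: compatible_fmrename)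
  then have "inf (gen (fmrename p g)) (gen f) \<noteq> bot" by (simp add: inf_gen_eq_bot_iff)
  then obtain h where h: "gen h \<le> gen (fmrename p g)" "gen h \<le> gen f"
    using gen_below_inf[OF infinite_values] by blast
  have "gen h \<le> B1_rename p x" using h(2) assms by (rule order_trans)
  then have "inf (gen h) (B1_rename p x) = gen h" by (rule inf.absorb1)
  then have "inf (gen h) (B1_rename p x) \<noteq> bot" by simp
  then obtain s where s: "gen s \<le> x" "inf (gen h) (gen (fmrename p s)) \<noteq> bot"
    unfolding B1_rename_def using inf_Sup_neq_bot by blast
  have "inf (gen h) (gen (fmrename p s)) \<le> inf (gen (fmrename p g)) (gen (fmrename p s))"
    using h(1) by (intro inf_mono) auto
  then have "inf (gen (fmrename p g)) (gen (fmrename p s)) \<noteq> bot"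
    using s(2) by (metis bot.extremum_unique)
  then have "compatible g s"
    by (simp add: inf_gen_eq_bot_iff compatible_fmrename fmrename_fmrename)
  then show False using compatible_le_disjoint[OF _ s(1) g(2)] compatible_sym by blast
qed

lemma gen_le_rename_iff:
  fixes x :: "('k, 'm) B1"
  shows "gen f \<le> B1_rename p x \<longleftrightarrow> gen (fmrename p f) \<le> x"
  using gen_le_renameD gen_rename_le[where p = p and f = "fmrename p f" and x = x] by (auto simp: fmrename_fmrename)

lemma B1_rename_rename:
  fixes x :: "('k, 'm) B1"
  shows "B1_rename p (B1_rename p x) = x"
proof (rule antisym)
  show "B1_rename p (B1_rename p x) \<le> x"
    by (subst le_iff_gens[OF infinite_values]) (simp add: gen_le_rename_iff fmrename_fmrename)
  show "x \<le> B1_rename p (B1_rename p x)"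
    by (subst le_iff_gens[OF infinite_values]) (simp add: gen_le_rename_iff fmrename_fmrename)
qed

lemma B1_rename_inf:
  fixes x y :: "('k, 'm) B1"
  shows "B1_rename p (inf x y) = inf (B1_rename p x) (B1_rename p y)"
proof (rule antisym)
  show "B1_rename p (inf x y) \<le> inf (B1_rename p x) (B1_rename p y)"
    by (simp add: B1_rename_mono)
  show "inf (B1_rename p x) (B1_rename p y) \<le> B1_rename p (inf x y)"
    by (subst le_iff_gens[OF infinite_values]) (simp add: gen_le_rename_iff)
qed

text \<open>Renaming does not change the restriction of a condition to \<open>Y\<close>, which gives
  one inequality; applying the involution to it gives the other.\<close>

lemma B1_rename_fixed:
  fixes x :: "('k, 'm) B1"
  assumes x: "supported x Y" and Y: "\<And>k. k \<in> Y \<Longrightarrow> p k = k"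
  shows "B1_rename p x = x"
proof -
  have le: "B1_rename p x \<le> x"
    unfolding le_iff_gens[OF infinite_values, of "B1_rename p x"] gen_le_rename_iff
  proof (intro allI impI)
    fix f assume "gen (fmrename p f) \<le> x"
    moreover have "fmrestrict_set Y (fmrename p f) = fmrestrict_set Y f"
      by (rule fmap_ext) (simp add: fmlookup_rename[OF inj_p] Y)
    ultimately have "gen (fmrestrict_set Y f) \<le> x" using supportedD[OF x] by metis
    moreover have "gen f \<le> gen (fmrestrict_set Y f)" by (rule gen_mono) simp
    ultimately show "gen f \<le> x" by simp
  qed
  from B1_rename_mono[OF le, of p] have "x \<le> B1_rename p x" by (simp add: B1_rename_rename)
  with le show ?thesis by simp
qed

lemma supported_rename:
  fixes x :: "('k, 'm) B1"
  assumes "supported x Y"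
  shows "supported (B1_rename p x) (p ` Y)"
  unfolding supported_def gen_le_rename_iff
proof (intro allI impI)
  fix f assume "gen (fmrename p f) \<le> x"
  then have "gen (fmrestrict_set Y (fmrename p f)) \<le> x" by (rule supportedD[OF assms])
  moreover have "fmrestrict_set Y (fmrename p f) = fmrename p (fmrestrict_set (p ` Y) f)"
    by (rule fmap_ext) (simp add: fmlookup_rename[OF inj_p] inj_image_mem_iff[OF inj_p])
  ultimately show "gen (fmrename p (fmrestrict_set (p ` Y) f)) \<le> x" by simp
qed

end

end

section \<open>Ultrafilters\<close>

text \<open>The empty \<open>S\<close> is included, so \<open>fip\<close> also forces
  \<open>top\<close> to differ from \<open>bot\<close>.\<close>

definition fip :: "'b::complete_lattice set \<Rightarrow> bool" where
  "fip A \<longleftrightarrow> (\<forall>S. finite S \<longrightarrow> S \<subseteq> A \<longrightarrow> Inf S \<noteq> bot)"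

text \<open>A finite subset of the union of a nonempty chain lies in one member;
  \<open>bot \<noteq> top\<close> handles the empty chain.\<close>

lemma fip_Union_chain:
  assumes "(bot :: 'b::complete_lattice) \<noteq> top"
    and "subset.chain UNIV C" and "\<And>A. A \<in> C \<Longrightarrow> fip (A :: 'b set)"
  shows "fip (\<Union>C)"
proof (cases "C = {}")
  case True
  then show ?thesis using assms(1) by (auto simp: fip_def)
next
  case False
  then show ?thesis
    using assms(2,3) finite_subset_Union_chain unfolding fip_def by metis
qed

lemma ultrafilter_finite_Inf:
  assumes "ultrafilter_on U" "finite S" "S \<subseteq> U"
  shows "Inf S \<in> (U :: 'b::{boolean_algebra, complete_lattice} set)"
  using assms(2,3) by induction (use assms(1) in \<open>auto simp: ultrafilter_on_def\<close>)

lemma ultrafilter_upward: "ultrafilter_on U \<Longrightarrow> x \<in> U \<Longrightarrow> x \<le> y \<Longrightarrow> y \<in> U"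
  unfolding ultrafilter_on_def by blast

lemma ultrafilter_inf_neq_bot: "ultrafilter_on U \<Longrightarrow> x \<in> U \<Longrightarrow> y \<in> U \<Longrightarrow> inf x y \<noteq> bot"
  unfolding ultrafilter_on_def by metis

text \<open>Zorn's lemma gives a maximal family \<open>M\<close> with the finite intersection
  property.\<close>

lemma fip_extends_to_ultrafilter:
  fixes A :: "'b::{boolean_algebra, complete_lattice} set"
  assumes A: "fip A"
  shows "\<exists>U. ultrafilter_on U \<and> A \<subseteq> U"
proof -
  have neq: "(bot :: 'b) \<noteq> top" using A[unfolded fip_def] Inf_empty by (metis empty_subsetI finite.emptyI)
  have "\<exists>M\<in>{B. fip B \<and> A \<subseteq> B}. \<forall>X\<in>{B. fip B \<and> A \<subseteq> B}. M \<subseteq> X \<longrightarrow> X = M"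
  proof (rule subset_Zorn_nonempty)
    fix C assume "C \<noteq> {}" and C: "subset.chain {B. fip B \<and> A \<subseteq> B} C"
    then have C': "C \<subseteq> {B. fip B \<and> A \<subseteq> B}" "subset.chain UNIV C"
      by (auto simp: subset_chain_def)
    then have "fip (\<Union>C)" by (intro fip_Union_chain[OF neq]) auto
    moreover have "A \<subseteq> \<Union>C" using \<open>C \<noteq> {}\<close> C'(1) by blast
    ultimately show "\<Union>C \<in> {B. fip B \<and> A \<subseteq> B}" by simp
  qed (use A in auto)
  then obtain M where M: "fip M" "A \<subseteq> M"
    and max: "\<And>X. fip X \<Longrightarrow> M \<subseteq> X \<Longrightarrow> X = M" by auto
  \<comment> \<open>By maximality, whatever meets all finite meets from \<open>M\<close> belongs to
    \<open>M\<close>; the ultrafilter laws are read off from this.\<close>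
  have mem: "x \<in> M \<longleftrightarrow> (\<forall>S. finite S \<longrightarrow> S \<subseteq> M \<longrightarrow> inf x (Inf S) \<noteq> bot)" for x
  proof
    assume "x \<in> M"
    then have "Inf (insert x S) \<noteq> bot" if "finite S" "S \<subseteq> M" for S
      using M(1)[unfolded fip_def, rule_format, of "insert x S"] that by simp
    then show "\<forall>S. finite S \<longrightarrow> S \<subseteq> M \<longrightarrow> inf x (Inf S) \<noteq> bot" by simp
  next
    assume r: "\<forall>S. finite S \<longrightarrow> S \<subseteq> M \<longrightarrow> inf x (Inf S) \<noteq> bot"
    have "fip (insert x M)"
      unfolding fip_def
    proof (intro allI impI notI)
      fix S assume "finite S" "S \<subseteq> insert x M" "Inf S = bot"
      moreover have "inf x (Inf (S - {x})) \<le> Inf S"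
      proof (rule Inf_greatest)
        fix z assume "z \<in> S"
        then show "inf x (Inf (S - {x})) \<le> z"
          by (cases "z = x") (auto intro: le_infI2 Inf_lower)
      qed
      ultimately have "inf x (Inf (S - {x})) = bot" by (simp add: bot.extremum_unique)
      moreover have "S - {x} \<subseteq> M" using \<open>S \<subseteq> insert x M\<close> by auto
      ultimately show False using r \<open>finite S\<close> by (meson finite_Diff)
    qed
    then show "x \<in> M" using max[of "insert x M"] by blast
  qed
  have "ultrafilter_on M"
    unfolding ultrafilter_on_def
  proof (intro conjI ballI allI impI)
    show "top \<in> M" unfolding mem using M(1) by (simp add: fip_def)
    show "bot \<notin> M" unfolding mem by (auto intro!: exI[of _ "{}"])
  next
    fix x y assume "x \<in> M" "y \<in> M"
    then have "Inf (insert x (insert y S)) \<noteq> bot" if "finite S" "S \<subseteq> M" for S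
      using M(1)[unfolded fip_def, rule_format, of "insert x (insert y S)"] that by simp
    then show "inf x y \<in> M" unfolding mem[of "inf x y"] by (simp add: inf.assoc)
  next
    fix x y assume "x \<in> M" "x \<le> y"
    then show "y \<in> M"
      unfolding mem[of x] mem[of y] by (metis inf_mono order_refl bot.extremum_unique)
  next
    fix x
    show "x \<in> M \<or> - x \<in> M"
    proof (rule ccontr)
      assume "\<not> ?thesis"
      then obtain S T where S: "finite S" "S \<subseteq> M" "inf x (Inf S) = bot"
        and T: "finite T" "T \<subseteq> M" "inf (- x) (Inf T) = bot"
        unfolding mem[of x] mem[of "- x"] by auto
      have "Inf S \<le> - x" using S(3) by (simp add: inf_shunt[symmetric] inf.commute)
      moreover have "Inf T \<le> x" using T(3) inf_shunt[of "Inf T" "- x"] by (simp add: inf.commute[of "Inf T"])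
      ultimately have "inf (Inf S) (Inf T) \<le> inf (- x) x" by (rule inf_mono)
      then have "Inf (S \<union> T) = bot" by (simp add: Inf_union_distrib bot.extremum_unique)
      then show False using M(1) S T by (metis fip_def finite_UnI le_sup_iff)
    qed
  qed
  then show ?thesis using M(2) by blast
qed

section \<open>Cardinalities\<close>

lemma card_of_iterate:
  fixes \<Phi> :: "'a set \<Rightarrow> 'a set"
  assumes L: "infinite L" and A: "|A| \<le>o |L|"
    and step: "\<And>X. |X| \<le>o |L| \<Longrightarrow> |\<Phi> X| \<le>o |L|"
  shows "|\<Union>n. (\<Phi> ^^ n) A| \<le>o |L|"
proof (rule card_of_UNION_ordLeq_infinite[OF L])
  show "|UNIV :: nat set| \<le>o |L|" using L infinite_iff_card_of_nat by blast
  have "|(\<Phi> ^^ n) A| \<le>o |L|" for n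
  proof (induction n)
    case 0
    show ?case unfolding funpow_0 by (rule A)
  next
    case (Suc n)
    show ?case unfolding funpow.simps comp_def by (rule step[OF Suc.IH])
  qed
  then show "\<forall>n\<in>UNIV. |(\<Phi> ^^ n) A| \<le>o |L|" by blast
qed

lemma card_of_Times_ordLeq_infinite:
  assumes L: "infinite L" and "|A| \<le>o |L|" "|B| \<le>o |L|"
  shows "|A \<times> B| \<le>o |L|"
  using card_of_Sigma_ordLeq_infinite[OF L assms(2), of "\<lambda>_. B"] assms(3) by auto

lemma card_of_Un_ordLeq_infinite:
  assumes L: "infinite L" and "|A| \<le>o |L|" "|B| \<le>o |L|"
  shows "|A \<union> B| \<le>o |L|"
  using assms
  by (intro card_of_Un_ordLeq_infinite_Field[OF _ _ _ card_of_Card_order]) (simp_all add: Field_card_of)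

lemma card_of_finite_ordLeq_infinite: "finite S \<Longrightarrow> infinite L \<Longrightarrow> |S| \<le>o |L|"
  by (metis card_of_ordLeq_finite card_of_Well_order ordLeq_total)

lemma card_of_image_ordLeq: "|A| \<le>o r \<Longrightarrow> |f ` A| \<le>o r"
  using card_of_image ordLeq_transitive by blast

text \<open>Every condition arises from the empty one by finitely many updates, and each round of
  updates stays within the size of \<open>L\<close>.\<close>

lemma card_of_fmaps:
  assumes L: "infinite L" and A: "|A| \<le>o |L|" and m: "|UNIV :: 'm set| \<le>o |L|"
  shows "|{f :: ('k, 'm) fmap. fmdom' f \<subseteq> A}| \<le>o |L|"
proof -
  define \<Phi> where "\<Phi> X = X \<union> (\<lambda>((k, v), f). fmupd k v f) ` ((A \<times> UNIV) \<times> X)"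
    for X :: "('k, 'm) fmap set"
  have le: "|\<Union>n. (\<Phi> ^^ n) {fmempty}| \<le>o |L|"
  proof (rule card_of_iterate[OF L])
    show "|{fmempty}| \<le>o |L|" using L by (intro card_of_finite_ordLeq_infinite) auto
    show "|\<Phi> X| \<le>o |L|" if "|X| \<le>o |L|" for X
      unfolding \<Phi>_def
      by (intro card_of_Un_ordLeq_infinite card_of_image_ordLeq card_of_Times_ordLeq_infinite L A m that)
  qed
  have "f \<in> (\<Union>n. (\<Phi> ^^ n) {fmempty})" if "fmdom' f \<subseteq> A" for f
    using that
  proof (induction f rule: fmap_induct)
    case fmempty
    show ?case by (rule UN_I[of 0]) auto
  next
    case (fmupd k v f)
    then obtain n where "f \<in> (\<Phi> ^^ n) {fmempty}" "k \<in> A" by auto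
    then have "fmupd k v f \<in> (\<Phi> ^^ Suc n) {fmempty}"
      by (auto simp: \<Phi>_def intro!: image_eqI[of _ _ "((k, v), f)"])
    then show ?case by blast
  qed
  then have "{f. fmdom' f \<subseteq> A} \<subseteq> (\<Union>n. (\<Phi> ^^ n) {fmempty})" by blast
  from ordLeq_transitive[OF card_of_mono1[OF this] le] show ?thesis .
qed

lemma card_of_fset:
  assumes "infinite (UNIV :: 'l set)"
  shows "|UNIV :: 'l fset set| \<le>o |UNIV :: 'l set|"
proof -
  have "u \<in> fmdom ` {f :: ('l, 'l) fmap. fmdom' f \<subseteq> UNIV}" for u :: "'l fset"
  proof (induction u)
    case empty
    show ?case by (rule image_eqI[of _ _ fmempty]) auto
  next
    case (insert x u)
    then obtain f :: "('l, 'l) fmap" where "u = fmdom f" by auto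
    then show ?case by (intro image_eqI[of _ _ "fmupd x x f"]) auto
  qed
  then have "fmdom ` {f :: ('l, 'l) fmap. fmdom' f \<subseteq> UNIV} = UNIV" by blast
  moreover have "|fmdom ` {f :: ('l, 'l) fmap. fmdom' f \<subseteq> UNIV}| \<le>o |UNIV :: 'l set|"
    by (intro card_of_image_ordLeq card_of_fmaps assms card_of_mono1) auto
  ultimately show ?thesis by simp
qed

text \<open>A function into subsets of \<open>'l\<close> is coded by a subset of the product of
  \<open>'l\<close> with itself, which embeds into \<open>'l\<close>.\<close>

lemma card_of_fun_Pow:
  assumes l: "infinite (UNIV :: 'l set)" and c: "|UNIV :: 'c set| \<le>o |UNIV :: 'l set set|"
  shows "|UNIV :: ('l \<Rightarrow> 'c) set| \<le>o |UNIV :: 'l set set|"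
proof -
  obtain e :: "'c \<Rightarrow> 'l set" where e: "inj e" using c card_of_ordLeq[of UNIV UNIV] by auto
  have "|UNIV \<times> UNIV :: ('l \<times> 'l) set| \<le>o |UNIV :: 'l set|"
    by (intro card_of_Times_ordLeq_infinite l card_of_mono1) auto
  then obtain t :: "'l \<times> 'l \<Rightarrow> 'l" where t: "inj t"
    using card_of_ordLeq[of "UNIV \<times> UNIV" UNIV] by auto
  have "inj (\<lambda>g :: 'l \<Rightarrow> 'c. t ` {(i, j). j \<in> e (g i)})"
  proof (rule injI)
    fix g h :: "'l \<Rightarrow> 'c"
    assume "t ` {(i, j). j \<in> e (g i)} = t ` {(i, j). j \<in> e (h i)}"
    then have "{(i, j). j \<in> e (g i)} = {(i, j). j \<in> e (h i)}" using t by (simp add: inj_image_eq_iff)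
    then have "e (g i) = e (h i)" for i by (auto simp: set_eq_iff)
    then show "g = h" using e by (auto simp: inj_eq)
  qed
  then show ?thesis using card_of_ordLeq[of UNIV UNIV] by blast
qed

text \<open>
  Closing off under chosen extensions in \<open>\<omega>\<close> steps replaces a chain condition: a set \<open>Y\<close> such
  that every condition over \<open>Y\<close> having an extension below \<open>b i\<close> has one over \<open>Y\<close>.
\<close>

lemma exists_small_support:
  fixes b :: "'i \<Rightarrow> ('k, 'm) B1"
  assumes L: "infinite L" and i: "|UNIV :: 'i set| \<le>o |L|" and m: "|UNIV :: 'm set| \<le>o |L|"
    and inf: "infinite (UNIV :: 'm set)"
  shows "\<exists>Y. |Y| \<le>o |L| \<and> (\<forall>i. supported (b i) Y)"
proof -
  define ext where "ext i f = (SOME g. f \<subseteq>\<^sub>f g \<and> gen g \<le> b i)" for i f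
  have ext: "f \<subseteq>\<^sub>f ext i f \<and> gen (ext i f) \<le> b i" if "f \<subseteq>\<^sub>f g" "gen g \<le> b i" for i f g
    unfolding ext_def using that by (intro someI[of "\<lambda>g. f \<subseteq>\<^sub>f g \<and> gen g \<le> b i"]) simp
  define \<Phi> where
    "\<Phi> X = X \<union> (\<Union>(i, f)\<in>UNIV \<times> {f. fmdom' f \<subseteq> X}. fmdom' (ext i f))" for X
  define Y where "Y = (\<Union>n. (\<Phi> ^^ n) {})"
  have finite_le: "|S| \<le>o |L|" if "finite S" for S :: "'k set"
    using card_of_finite_ordLeq_infinite[OF that L] .
  have "|Y| \<le>o |L|"
    unfolding Y_def
  proof (rule card_of_iterate[OF L])
    show "|\<Phi> X| \<le>o |L|" if "|X| \<le>o |L|" for X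
      unfolding \<Phi>_def
    proof (intro card_of_Un_ordLeq_infinite L that card_of_UNION_ordLeq_infinite)
      show "|(UNIV :: 'i set) \<times> {f :: ('k, 'm) fmap. fmdom' f \<subseteq> X}| \<le>o |L|"
        by (intro card_of_Times_ordLeq_infinite L i card_of_fmaps m that)
    qed (use finite_le in auto)
  qed (simp add: finite_le)
  have mono: "(\<Phi> ^^ n) {} \<subseteq> (\<Phi> ^^ n') {}" if "n \<le> n'" for n n'
    using that by (rule lift_Suc_mono_le[rotated]) (auto simp: \<Phi>_def)
  have chain: "subset.chain UNIV (range (\<lambda>n. (\<Phi> ^^ n) {}))"
    unfolding subset_chain_def using mono nat_le_linear by blast
  have ext_Y: "fmdom' (ext i f) \<subseteq> Y" if f: "fmdom' f \<subseteq> Y" for i f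
  proof -
    \<comment> \<open>The finite domain of \<open>f\<close> lies in a single stage, and the next
      stage contains the chosen extension.\<close>
    obtain n where "fmdom' f \<subseteq> (\<Phi> ^^ n) {}"
      using finite_subset_Union_chain[OF finite_fmdom' f[unfolded Y_def] _ chain] by auto
    then have "fmdom' (ext i f) \<subseteq> (\<Phi> ^^ Suc n) {}" by (auto simp: \<Phi>_def)
    then show ?thesis unfolding Y_def by blast
  qed
  have "supported (b i) Y" for i
  proof -
    let ?d = "Sup (gen ` {f. gen f \<le> b i \<and> fmdom' f \<subseteq> Y})"
    have "b i \<le> ?d"
    proof (rule ccontr)
      assume "\<not> b i \<le> ?d"
      then obtain g where g: "gen g \<le> b i" "gen g \<le> - ?d" using not_le_gen[OF inf] by blast
      \<comment> \<open>The extension chosen for the restriction of \<open>g\<close> stays over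
        \<open>Y\<close>, so it lies below the join, yet it is compatible with
        \<open>g\<close>.\<close>
      define e where "e = ext i (fmrestrict_set Y g)"
      have e: "fmrestrict_set Y g \<subseteq>\<^sub>f e" "gen e \<le> b i"
        unfolding e_def using ext[OF _ g(1), of "fmrestrict_set Y g"] by simp_all
      have dom: "fmdom' e \<subseteq> Y" unfolding e_def by (intro ext_Y) (simp add: fmdom'_restrict_set)
      have "gen e \<le> ?d" using e(2) dom by (intro Sup_upper) auto
      moreover have "compatible e g"
        unfolding compatible_iff
      proof (intro allI impI)
        fix k v w assume k: "fmlookup e k = Some v" "fmlookup g k = Some w"
        then have "k \<in> Y" using dom by (auto intro: fmdom'I)
        then have "fmlookup e k = Some w" using fmsubsetD[OF e(1)] k(2) by simp
        then show "v = w" using k(1) by simp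
      qed
      ultimately show False using compatible_le_disjoint g(2) by blast
    qed
    moreover have "?d \<le> b i" by (auto intro: Sup_least)
    ultimately have "b i = ?d" by (rule antisym)
    moreover have "supported ?d Y" by (rule supported_Sup_gen[OF inf]) simp
    ultimately show ?thesis by simp
  qed
  then show ?thesis using \<open>|Y| \<le>o |L|\<close> by blast
qed

section \<open>The coordinates in their cardinal order\<close>

text \<open>The step consults values at predecessors only, so the truncation inside
  \<open>wfrec\<close> has no effect.\<close>

lemma wf_recursion_Union:
  assumes "wf R"
  shows "\<exists>T. \<forall>\<alpha>. T \<alpha> = step \<alpha> (\<Union>\<beta>\<in>{\<beta>. (\<beta>, \<alpha>) \<in> R}. T \<beta>)"
proof (intro exI allI)
  let ?F = "\<lambda>T \<alpha>. step \<alpha> (\<Union>\<beta>\<in>{\<beta>. (\<beta>, \<alpha>) \<in> R}. T \<beta>)"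
  fix \<alpha>
  show "wfrec R ?F \<alpha> = step \<alpha> (\<Union>\<beta>\<in>{\<beta>. (\<beta>, \<alpha>) \<in> R}. wfrec R ?F \<beta>)"
    by (subst wfrec[OF assms]) (simp add: cut_apply cong: SUP_cong_simp)
qed

lemma below_iff: "\<beta> \<in> below \<alpha> \<longleftrightarrow> \<beta> \<noteq> \<alpha> \<and> (\<beta>, \<alpha>) \<in> |UNIV :: 'l set set|"
  for \<alpha> :: "'l set"
  by (simp add: below_def underS_def)

lemma wf_below: "wf {(\<beta>, \<alpha>). \<beta> \<in> below (\<alpha> :: 'l set)}"
proof -
  have "{(\<beta>, \<alpha>). \<beta> \<in> below (\<alpha> :: 'l set)} = |UNIV :: 'l set set| - Id"
    by (auto simp: below_iff)
  then show ?thesis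
    using card_of_well_order_on[of "UNIV :: 'l set set"] by (simp add: well_order_on_def)
qed

lemma below_linear: "\<alpha> = \<beta> \<or> \<alpha> \<in> below \<beta> \<or> \<beta> \<in> below (\<alpha> :: 'l set)"
proof -
  have "total ( |UNIV :: 'l set set| )"
    using card_of_well_order_on[of "UNIV :: 'l set set"]
    by (simp add: well_order_on_def linear_order_on_def)
  then show ?thesis unfolding below_iff total_on_def by blast
qed

lemma below_trans: "\<gamma> \<in> below \<beta> \<Longrightarrow> \<beta> \<in> below \<alpha> \<Longrightarrow> \<gamma> \<in> below (\<alpha> :: 'l set)"
proof -
  assume *: "\<gamma> \<in> below \<beta>" "\<beta> \<in> below \<alpha>"
  have "trans ( |UNIV :: 'l set set| )" "antisym ( |UNIV :: 'l set set| )"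
    using card_of_well_order_on[of "UNIV :: 'l set set"]
    by (simp_all add: well_order_on_def linear_order_on_def partial_order_on_def preorder_on_def)
  with * show ?thesis unfolding below_iff by (metis antisymD transD)
qed

lemma card_of_below: "|below \<alpha>| <o |UNIV :: 'l set set|" for \<alpha> :: "'l set"
  unfolding below_def by (intro card_of_underS card_of_Card_order) (simp add: Field_card_of)

section \<open>The transfinite construction\<close>

lemma multiplicative_lower_bound:
  assumes "multiplicative b" "finite V"
  shows "\<exists>v. \<forall>u\<in>V. b v \<le> b u"
  using assms(2)
proof induction
  case (insert u V)
  then obtain v where "\<forall>u\<in>V. b v \<le> b u" by blast
  moreover have "b (u |\<union>| v) = inf (b u) (b v)"
    using assms(1) by (simp add: multiplicative_def)
  ultimately have "\<forall>w\<in>insert u V. b (u |\<union>| v) \<le> b w" by (auto intro: le_infI2)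
  then show ?case ..
qed simp

context
  assumes infinite_values: "infinite (UNIV :: 'm set)"
begin

text \<open>A finite meet splits into an element of \<open>U\<close> over
  \<open>Y \<union> Z\<close> and a part bounded below by a single \<open>b v\<close>. Were they
  disjoint, interpolation would give an element of \<open>U\<close> over \<open>Y\<close> disjoint
  from \<open>b v\<close>, against the last assumption.\<close>

lemma fip_stage:
  fixes A U :: "('k, 'm) B1 set" and b :: "'l fset \<Rightarrow> ('k, 'm) B1"
  assumes U: "ultrafilter_on U" "A \<subseteq> U"
    and A: "\<And>x. x \<in> A \<Longrightarrow> supported x (Y \<union> Z)"
    and WZ: "W \<inter> Z = {}"
    and b: "multiplicative b" "\<And>u. supported (b u) (Y \<union> W)"
    and comp: "\<And>u c. c \<in> U \<Longrightarrow> supported c Y \<Longrightarrow> inf (b u) c \<noteq> bot"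
  shows "fip (A \<union> {c \<in> U. supported c Y} \<union> range b)"
  unfolding fip_def
proof (intro allI impI)
  fix S assume S: "finite S" "S \<subseteq> A \<union> {c \<in> U. supported c Y} \<union> range b"
  define S1 where "S1 = S \<inter> (A \<union> {c \<in> U. supported c Y})"
  define S2 where "S2 = S - S1"
  have "S2 \<subseteq> range b" "finite S2" using S by (auto simp: S1_def S2_def)
  then obtain V where V: "finite V" "S2 = b ` V" by (meson finite_subset_image)
  obtain v where v: "\<forall>u\<in>V. b v \<le> b u" using multiplicative_lower_bound[OF b(1) V(1)] by blast
  have "S1 \<subseteq> U" "finite S1" using U(2) S(1) by (auto simp: S1_def)
  then have c: "Inf S1 \<in> U" using ultrafilter_finite_Inf[OF U(1)] by blast
  have "supported x (Y \<union> Z)" if "x \<in> S1" for x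
    using that A supported_mono[of x Y "Y \<union> Z"] by (auto simp: S1_def)
  then have sc: "supported (Inf S1) (Y \<union> Z)" by (rule supported_Inf)
  have "inf (b v) (Inf S1) \<noteq> bot"
  proof
    assume "inf (b v) (Inf S1) = bot"
    then obtain d where "supported d Y" "Inf S1 \<le> d" "inf (b v) d = bot"
      using interpolation[OF infinite_values b(2) sc] WZ by blast
    then show False using comp[of d v] ultrafilter_upward[OF U(1) c] by blast
  qed
  moreover have "inf (b v) (Inf S1) \<le> Inf S"
  proof (rule Inf_greatest)
    fix x assume "x \<in> S"
    then consider "x \<in> S1" | "x \<in> S2" by (auto simp: S2_def)
    then show "inf (b v) (Inf S1) \<le> x"
      by cases (use V(2) v in \<open>auto intro: le_infI1 le_infI2 Inf_lower\<close>)
  qed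
  ultimately show "Inf S \<noteq> bot" by (metis bot.extremum_unique)
qed

text \<open>The requirement on \<open>b'\<close> can refer to the final \<open>D\<close>, because
  stage \<alpha> settles which elements over \<open>below \<alpha>\<close> belong to
  \<open>D\<close>.\<close>

lemma ultrafilter_construction:
  fixes b :: "'l set \<Rightarrow> 'l fset \<Rightarrow> ('l set, 'm) B1" and W :: "'l set \<Rightarrow> 'l set set"
  assumes W: "\<And>\<alpha> \<beta>. \<alpha> \<noteq> \<beta> \<Longrightarrow> W \<alpha> \<inter> W \<beta> = {}"
  shows "\<exists>D. ultrafilter_on D \<and>
    (\<forall>\<alpha> b'. multiplicative b' \<longrightarrow> (\<forall>u. b' u \<le> b \<alpha> u) \<longrightarrow>
      (\<forall>u. supported (b' u) (below \<alpha> \<union> W \<alpha>)) \<longrightarrow>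
      (\<forall>u. \<forall>c\<in>D. supported c (below \<alpha>) \<longrightarrow> inf (b' u) c \<noteq> bot) \<longrightarrow>
      (\<exists>b''. multiplicative b'' \<and> range b'' \<subseteq> D \<and> (\<forall>u. b'' u \<le> b \<alpha> u)))"
proof -
  define U where "U A = (SOME U. ultrafilter_on U \<and> A \<subseteq> U)" for A :: "('l set, 'm) B1 set"
  \<comment> \<open>Only the part over \<open>below \<alpha>\<close> of the auxiliary ultrafilter is
    kept; all of it would commit every coordinate.\<close>
  define K where "K \<alpha> A = {c \<in> U A. supported c (below \<alpha>)}" for \<alpha> A
  define good where "good \<alpha> A b' \<longleftrightarrow> multiplicative b' \<and> (\<forall>u. b' u \<le> b \<alpha> u) \<and>
    (\<forall>u. supported (b' u) (below \<alpha> \<union> W \<alpha>)) \<and>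
    (\<forall>u. \<forall>c\<in>K \<alpha> A. inf (b' u) c \<noteq> bot)" for \<alpha> A b'
  define G where "G \<alpha> A = (if \<exists>b'. good \<alpha> A b' then range (SOME b'. good \<alpha> A b') else {})" for \<alpha> A
  obtain T where T: "\<And>\<alpha>. T \<alpha> = K \<alpha> (\<Union>\<beta>\<in>below \<alpha>. T \<beta>) \<union> G \<alpha> (\<Union>\<beta>\<in>below \<alpha>. T \<beta>)"
    using wf_recursion_Union[OF wf_below, of "\<lambda>\<alpha> A. K \<alpha> A \<union> G \<alpha> A"] by auto
  define A where "A \<alpha> = (\<Union>\<beta>\<in>below \<alpha>. T \<beta>)" for \<alpha>
  have T_eq: "T \<alpha> = K \<alpha> (A \<alpha>) \<union> G \<alpha> (A \<alpha>)" for \<alpha> unfolding A_def by (rule T)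
  have G_cases: "G \<alpha> (A \<alpha>) = {} \<or> (\<exists>b'. good \<alpha> (A \<alpha>) b' \<and> G \<alpha> (A \<alpha>) = range b')" for \<alpha>
    unfolding G_def by (metis someI_ex)
  have supp_T: "supported x (below \<alpha> \<union> W \<alpha>)" if "x \<in> T \<alpha>" for x \<alpha>
    using that G_cases[of \<alpha>] supported_mono[of x "below \<alpha>" "below \<alpha> \<union> W \<alpha>"]
    unfolding T_eq K_def good_def by auto
  have AT: "A \<beta> \<union> T \<beta> \<subseteq> A \<alpha>" if "\<beta> \<in> below \<alpha>" for \<alpha> \<beta>
    using that below_trans unfolding A_def by blast
  have chain: "subset.chain UNIV ((\<lambda>\<beta>. A \<beta> \<union> T \<beta>) ` B)" for B
  proof -
    have "A \<alpha> \<union> T \<alpha> \<subseteq> A \<beta> \<union> T \<beta> \<or> A \<beta> \<union> T \<beta> \<subseteq> A \<alpha> \<union> T \<alpha>" for \<alpha> \<beta>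
      using below_linear[of \<alpha> \<beta>] AT[of \<alpha> \<beta>] AT[of \<beta> \<alpha>] by blast
    then show ?thesis by (auto simp: subset_chain_def)
  qed
  have UA: "ultrafilter_on (U (A \<alpha>)) \<and> A \<alpha> \<subseteq> U (A \<alpha>)" if "fip (A \<alpha>)" for \<alpha>
    unfolding U_def using fip_extends_to_ultrafilter[OF that] by (rule someI_ex)
  have fip_A: "fip (A \<alpha>)" if "\<And>\<beta>. \<beta> \<in> below \<alpha> \<Longrightarrow> fip (A \<beta> \<union> T \<beta>)" for \<alpha>
  proof -
    \<comment> \<open>Successor and limit stages are treated alike, as unions of increasing
      chains.\<close>
    have "A \<alpha> = \<Union>((\<lambda>\<beta>. A \<beta> \<union> T \<beta>) ` below \<alpha>)" using below_trans unfolding A_def by blast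
    then show ?thesis using fip_Union_chain[OF B1_bot_neq_top chain] that by auto
  qed
  have fip_AT: "fip (A \<alpha> \<union> T \<alpha>)" for \<alpha>
  proof (induction \<alpha> rule: wf_induct_rule[OF wf_below])
    case (1 \<alpha>)
    then have "fip (A \<alpha>)" by (intro fip_A) simp
    note U = conjunct1[OF UA[OF this]] conjunct2[OF UA[OF this]]
    show ?case
    proof (cases "G \<alpha> (A \<alpha>) = {}")
      case True
      then have "A \<alpha> \<union> T \<alpha> \<subseteq> U (A \<alpha>)" using U(2) by (auto simp: T_eq K_def)
      then show ?thesis
        unfolding fip_def using ultrafilter_finite_Inf[OF U(1)] U(1)
        by (metis order_trans ultrafilter_on_def)
    next
      case False
      then obtain b' where b': "good \<alpha> (A \<alpha>) b'" "G \<alpha> (A \<alpha>) = range b'" using G_cases by blast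
      have "fip (A \<alpha> \<union> {c \<in> U (A \<alpha>). supported c (below \<alpha>)} \<union> range b')"
      proof (rule fip_stage[OF U])
        \<comment> \<open>The set \<open>Z\<close> of amalgamation is the union of the earlier
          blocks, disjoint from the block of \<alpha>.\<close>
        show "supported x (below \<alpha> \<union> (\<Union>\<beta>\<in>below \<alpha>. W \<beta>))" if x: "x \<in> A \<alpha>" for x
        proof -
          obtain \<beta> where \<beta>: "\<beta> \<in> below \<alpha>" "x \<in> T \<beta>" using x by (auto simp: A_def)
          show ?thesis
            by (rule supported_mono[OF supp_T[OF \<beta>(2)]]) (use \<beta>(1) below_trans in blast)
        qed
        have "W \<alpha> \<inter> W \<beta> = {}" if "\<beta> \<in> below \<alpha>" for \<beta>
          by (rule W) (use that in \<open>auto simp: below_iff\<close>)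
        then show "W \<alpha> \<inter> (\<Union>\<beta>\<in>below \<alpha>. W \<beta>) = {}" by (simp add: Int_UN_distrib)
      qed (use b'(1) in \<open>auto simp: good_def K_def\<close>)
      then show ?thesis by (simp add: T_eq K_def b'(2) Un_assoc)
    qed
  qed
  have "fip (\<Union>\<alpha>. A \<alpha> \<union> T \<alpha>)" by (rule fip_Union_chain[OF B1_bot_neq_top chain]) (use fip_AT in auto)
  then obtain D where D: "ultrafilter_on D" "(\<Union>\<alpha>. A \<alpha> \<union> T \<alpha>) \<subseteq> D"
    using fip_extends_to_ultrafilter by blast
  \<comment> \<open>\<open>K\<close> contains each element over \<open>below \<alpha>\<close> or its
    complement, so \<open>D\<close> cannot differ from it there.\<close>
  have K_D: "K \<alpha> (A \<alpha>) = {c \<in> D. supported c (below \<alpha>)}" for \<alpha>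
  proof -
    have U: "ultrafilter_on (U (A \<alpha>))" using UA fip_A fip_AT by blast
    have sub: "K \<alpha> (A \<alpha>) \<subseteq> D" using D(2) T_eq by blast
    have "c \<in> U (A \<alpha>)" if c: "c \<in> D" "supported c (below \<alpha>)" for c
    proof (rule ccontr)
      assume "c \<notin> U (A \<alpha>)"
      then have "- c \<in> U (A \<alpha>)" using U unfolding ultrafilter_on_def by blast
      then have "- c \<in> D" using sub supported_uminus[OF infinite_values c(2)] by (auto simp: K_def)
      then show False using ultrafilter_inf_neq_bot[OF D(1) c(1)] by fastforce
    qed
    then show ?thesis using sub by (auto simp: K_def)
  qed
  show ?thesis
  proof (intro exI[of _ D] conjI allI impI D(1))
    fix \<alpha> b'
    assume "multiplicative b'" "\<forall>u. b' u \<le> b \<alpha> u"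
      "\<forall>u. supported (b' u) (below \<alpha> \<union> W \<alpha>)"
      "\<forall>u. \<forall>c\<in>D. supported c (below \<alpha>) \<longrightarrow> inf (b' u) c \<noteq> bot"
    then have "good \<alpha> (A \<alpha>) b'" by (simp add: good_def K_D)
    then have ex: "\<exists>b'. good \<alpha> (A \<alpha>) b'" by blast
    then have G: "G \<alpha> (A \<alpha>) = range (SOME b'. good \<alpha> (A \<alpha>) b')" by (simp add: G_def)
    \<comment> \<open>The refinement inside \<open>D\<close> is the one chosen at stage \<alpha>,
      possibly not the given \<open>b'\<close>.\<close>
    have "good \<alpha> (A \<alpha>) (SOME b'. good \<alpha> (A \<alpha>) b')" using ex by (rule someI_ex)
    moreover have "G \<alpha> (A \<alpha>) \<subseteq> D" using D(2) T_eq by blast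
    ultimately show "\<exists>b''. multiplicative b'' \<and> range b'' \<subseteq> D \<and> (\<forall>u. b'' u \<le> b \<alpha> u)"
      unfolding G good_def by blast
  qed
qed

end

section \<open>Relocation and enumeration\<close>

lemma card_of_UNIV_Pow: "|UNIV :: 'l set| <o |UNIV :: 'l set set|"
  using card_of_Pow[of "UNIV :: 'l set"] by simp

lemma swap_involution:
  assumes j: "inj_on j Y" and disj: "j ` Y \<inter> Y = {}"
  shows "\<exists>p. (\<forall>k. p (p k) = k) \<and> (\<forall>k\<in>Y. p k = j k) \<and> (\<forall>k. k \<notin> Y \<longrightarrow> k \<notin> j ` Y \<longrightarrow> p k = k)"
proof (intro exI conjI allI ballI impI)
  let ?p = "\<lambda>k. if k \<in> Y then j k else if k \<in> j ` Y then inv_into Y j k else k"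
  fix k
  show "?p (?p k) = k"
  proof (cases "k \<in> Y")
    case True
    then have "j k \<notin> Y" "j k \<in> j ` Y" using disj by auto
    then show ?thesis using True j by simp
  next
    case False
    then show ?thesis by (auto simp: inv_into_into f_inv_into_f)
  qed
qed auto

text \<open>If \<open>W\<close> had too little room outside \<open>Y\<close> and
  \<open>below \<alpha>\<close>, it would be covered by two sets smaller than the infinite
  \<open>L\<close>.\<close>

lemma fresh_injection:
  assumes inf: "infinite L" and "|below \<alpha>| <o |L|" "|Y| <o |L|" "|L| \<le>o |W|"
  shows "\<exists>j. inj_on j Y \<and> j ` Y \<subseteq> W - (Y \<union> below \<alpha>)"
proof -
  let ?V = "Y \<union> below \<alpha>"
  have V: "|?V| <o |L|" using assms by (intro card_of_Un_ordLess_infinite)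
  have "|Y| \<le>o |W - ?V|"
  proof (rule ccontr)
    assume "\<not> ?thesis"
    then have "|W - ?V| <o |Y|" by (simp add: card_of_Well_order not_ordLeq_iff_ordLess)
    then have "|W - ?V| <o |L|" using assms(3) by (rule ordLess_transitive)
    from card_of_Un_ordLess_infinite[OF inf this V] have "|(W - ?V) \<union> ?V| <o |L|" .
    moreover have "|W| \<le>o |(W - ?V) \<union> ?V|" by (rule card_of_mono1) blast
    ultimately have "|W| <o |L|" by (metis ordLeq_ordLess_trans)
    then show False using assms(4) by (simp add: not_ordLess_ordLeq)
  qed
  then show ?thesis by (simp flip: card_of_ordLeq)
qed

text \<open>The sequence has a small support \<open>Y\<close>. Exchanging the coordinates of
  \<open>Y\<close> outside \<open>below \<alpha>\<close> with fresh ones in \<open>W\<close> induces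
  an automorphism fixing each \<open>b u\<close> and each relevant \<open>c\<close>, so all
  requirements are carried over.\<close>

lemma relocation:
  fixes b' :: "'l fset \<Rightarrow> ('l set, 'm) B1"
  assumes inf_m: "infinite (UNIV :: 'm set)" and ml: "|UNIV :: 'm set| \<le>o |UNIV :: 'l set|"
    and W: "|UNIV :: 'l set set| \<le>o |W|"
    and mult: "multiplicative b'" and le: "\<And>u. b' u \<le> b u"
    and b: "\<And>u. supported (b u) (below \<alpha>)"
    and comp: "\<And>u c. c \<in> D \<Longrightarrow> supported c (below \<alpha>) \<Longrightarrow> inf (b' u) c \<noteq> bot"
  shows "\<exists>b'' :: 'l fset \<Rightarrow> ('l set, 'm) B1. multiplicative b'' \<and> (\<forall>u. b'' u \<le> b u) \<and>
    (\<forall>u. supported (b'' u) (below \<alpha> \<union> W)) \<and>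
    (\<forall>u. \<forall>c\<in>D. supported c (below \<alpha>) \<longrightarrow> inf (b'' u) c \<noteq> bot)"
proof -
  have inf_l: "infinite (UNIV :: 'l set)" using inf_m ml card_of_ordLeq_infinite by blast
  obtain Y where Y: "|Y| \<le>o |UNIV :: 'l set|" "\<And>u. supported (b' u) Y"
    using exists_small_support[OF inf_l card_of_fset[OF inf_l] ml inf_m] by blast
  have "infinite (UNIV :: 'l set set)" using inf_l by (simp add: Finite_Set.finite_set)
  from fresh_injection[OF this card_of_below ordLeq_ordLess_trans[OF Y(1) card_of_UNIV_Pow] W]
  obtain j where j: "inj_on j Y" "j ` Y \<subseteq> W - (Y \<union> below \<alpha>)" by blast
  have "inj_on j (Y - below \<alpha>)" "j ` (Y - below \<alpha>) \<inter> (Y - below \<alpha>) = {}"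
    using j by (auto intro: inj_on_diff)
  from swap_involution[OF this] obtain p where p: "\<And>k. p (p k) = k"
    "\<And>k. k \<in> Y - below \<alpha> \<Longrightarrow> p k = j k"
    "\<And>k. k \<notin> Y - below \<alpha> \<Longrightarrow> k \<notin> j ` (Y - below \<alpha>) \<Longrightarrow> p k = k" by metis
  have fix_below: "p k = k" if "k \<in> below \<alpha>" for k using that j(2) by (intro p(3)) auto
  have image: "p ` Y \<subseteq> below \<alpha> \<union> W" 
  proof (rule image_subsetI)
    fix k assume "k \<in> Y"
    then show "p k \<in> below \<alpha> \<union> W"
      using fix_below[of k] p(2)[of k] j(2) by (cases "k \<in> below \<alpha>") auto
  qed
  define b'' where "b'' u = B1_rename p (b' u)" for u
  show ?thesis
  proof (intro exI[of _ b''] conjI allI ballI impI)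
    show "multiplicative b''"
      using mult by (simp add: multiplicative_def b''_def flip: B1_rename_inf[OF p(1) inf_m])
    show "b'' u \<le> b u" for u
      using B1_rename_mono[OF le[of u], of p] B1_rename_fixed[OF p(1) inf_m b[of u] fix_below]
      by (simp add: b''_def)
    show "supported (b'' u) (below \<alpha> \<union> W)" for u
      using supported_mono[OF supported_rename[OF p(1) inf_m Y(2)] image] by (simp add: b''_def)
    show "inf (b'' u) c \<noteq> bot" if c: "c \<in> D" "supported c (below \<alpha>)" for u c
    proof
      assume "inf (b'' u) c = bot"
      then have "B1_rename p (inf (b' u) c) = bot"
        by (simp add: B1_rename_inf[OF p(1) inf_m] b''_def B1_rename_fixed[OF p(1) inf_m c(2) fix_below])
      then have "inf (b' u) c = bot"
        using B1_rename_rename[OF p(1) inf_m] B1_rename_bot by metis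
      then show False using comp[OF c] by blast
    qed
  qed
qed

text \<open>
  A diagonal argument showing that \<open>2\<^sup>\<lambda>\<close> has cofinality greater than \<open>\<lambda>\<close>; the free value \<open>c\<close>
  makes each value occur at arbitrarily late stages.
\<close>

lemma cofinal_enumeration:
  fixes \<phi> :: "'l set \<Rightarrow> ('l \<Rightarrow> 'l set) \<times> 'c" and \<omega> :: "'l \<Rightarrow> 'l set"
  assumes "surj \<phi>" and inf_l: "infinite (UNIV :: 'l set)"
  shows "\<exists>\<alpha>. snd (\<phi> \<alpha>) = c \<and> range \<omega> \<subseteq> below \<alpha>"
proof -
  \<comment> \<open>The segment up to and including \<open>\<omega> i\<close> is too small for its
    values at \<open>i\<close> to exhaust all subsets; \<open>g i\<close> is a missed one.\<close>
  have "\<exists>x. x \<notin> (\<lambda>\<alpha>. fst (\<phi> \<alpha>) i) ` (below (\<omega> i) \<union> {\<omega> i})" for i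
  proof (rule ccontr)
    let ?S = "below (\<omega> i) \<union> {\<omega> i}"
    assume "\<not> ?thesis"
    then have "(\<lambda>\<alpha>. fst (\<phi> \<alpha>) i) ` ?S = UNIV" by blast
    then have "|UNIV :: 'l set set| \<le>o |?S|" using card_of_image[of _ ?S] by metis
    moreover have "|?S| <o |UNIV :: 'l set set|"
    proof (rule card_of_Un_ordLess_infinite)
      show "infinite (UNIV :: 'l set set)" using inf_l by (simp add: Finite_Set.finite_set)
      have "|{\<omega> i}| \<le>o |UNIV :: 'l set|" by (rule card_of_singl_ordLeq) simp
      then show "|{\<omega> i}| <o |UNIV :: 'l set set|"
        using card_of_UNIV_Pow by (rule ordLeq_ordLess_trans)
    qed (rule card_of_below)
    ultimately show False by (simp add: not_ordLess_ordLeq)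
  qed
  then obtain g where g: "\<And>i. g i \<notin> (\<lambda>\<alpha>. fst (\<phi> \<alpha>) i) ` (below (\<omega> i) \<union> {\<omega> i})" by metis
  \<comment> \<open>An index of \<open>(g, c)\<close> cannot lie in any of these segments, so it is
    above every \<open>\<omega> i\<close>.\<close>
  obtain \<alpha> where \<alpha>: "\<phi> \<alpha> = (g, c)" using assms(1) by (metis surjD)
  have "\<omega> i \<in> below \<alpha>" for i
  proof -
    have "\<alpha> \<notin> below (\<omega> i) \<union> {\<omega> i}"
    proof
      assume "\<alpha> \<in> below (\<omega> i) \<union> {\<omega> i}"
      then have "fst (\<phi> \<alpha>) i \<in> (\<lambda>\<alpha>. fst (\<phi> \<alpha>) i) ` (below (\<omega> i) \<union> {\<omega> i})" by (rule imageI)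
      then show False using g[of i] \<alpha> by simp
    qed
    then show ?thesis using below_linear[of \<alpha> "\<omega> i"] by blast
  qed
  then show ?thesis using \<alpha> by (intro exI[of _ \<alpha>]) auto
qed

section \<open>Coding sequences by the generators below their values\<close>

lemma exists_range:
  assumes "|A| \<le>o |UNIV :: 'l set|" "A \<noteq> {}"
  shows "\<exists>g :: 'l \<Rightarrow> 'a. range g = A"
  using assms card_of_ordLeq2[of A "UNIV :: 'l set"] by blast

text \<open>The first component feeds the diagonal argument; the second codes a sequence by
  \<lambda> many pairs of an index set and a condition.\<close>

lemma exists_enumeration:
  assumes inf_l: "infinite (UNIV :: 'l set)" and ml: "|UNIV :: 'm set| \<le>o |UNIV :: 'l set|"
  shows "\<exists>\<phi> :: 'l set \<Rightarrow> ('l \<Rightarrow> 'l set) \<times> ('l \<Rightarrow> 'l fset \<times> ('l set, 'm) fmap). surj \<phi>"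
proof -
  have L: "infinite (UNIV :: 'l set set)" using inf_l by (simp add: Finite_Set.finite_set)
  have lL: "|UNIV :: 'l set| \<le>o |UNIV :: 'l set set|"
    using card_of_UNIV_Pow by (rule ordLess_imp_ordLeq)
  have "|{f :: ('l set, 'm) fmap. fmdom' f \<subseteq> UNIV}| \<le>o |UNIV :: 'l set set|"
    by (intro card_of_fmaps L card_of_mono1 ordLeq_transitive[OF ml lL]) simp
  then have "|(UNIV :: 'l fset set) \<times> (UNIV :: ('l set, 'm) fmap set)| \<le>o |UNIV :: 'l set set|"
    by (intro card_of_Times_ordLeq_infinite L ordLeq_transitive[OF card_of_fset[OF inf_l] lL]) simp
  then have "|UNIV :: ('l \<Rightarrow> 'l fset \<times> ('l set, 'm) fmap) set| \<le>o |UNIV :: 'l set set|"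
    by (intro card_of_fun_Pow inf_l) simp
  moreover have "|UNIV :: ('l \<Rightarrow> 'l set) set| \<le>o |UNIV :: 'l set set|"
    by (intro card_of_fun_Pow inf_l card_of_mono1) simp
  ultimately have "|(UNIV :: ('l \<Rightarrow> 'l set) set) \<times>
      (UNIV :: ('l \<Rightarrow> 'l fset \<times> ('l set, 'm) fmap) set)| \<le>o |UNIV :: 'l set set|"
    by (intro card_of_Times_ordLeq_infinite L)
  then show ?thesis using exists_range[of "UNIV \<times> UNIV", where 'l = "'l set"] by simp
qed

text \<open>The part of \<open>b u\<close> outside the join misses every member of the antichain:
  those below \<open>b u\<close> are below the join, the others below \<open>- b u\<close>. By
  maximality this part is zero.\<close>

lemma support_eq_Sup:
  fixes b :: "'l fset \<Rightarrow> ('k, 'm) B1"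
  assumes "support b X"
  shows "b u = Sup (gen ` {f. gen f \<in> X \<and> gen f \<le> b u})"
proof (rule antisym)
  let ?d = "Sup (gen ` {f. gen f \<in> X \<and> gen f \<le> b u})"
  show "?d \<le> b u" by (auto intro: Sup_least)
  obtain A where A: "maximal_antichain A" "A \<subseteq> X" "\<forall>x\<in>A. x \<le> b u \<or> x \<le> - b u"
    and X: "X \<subseteq> range gen"
    using assms unfolding support_def by blast
  define y where "y = inf (b u) (- ?d)"
  have disj: "inf y a = bot" if a: "a \<in> A" for a
  proof -
    obtain f where f: "a = gen f" "gen f \<in> X" using a A(2) X by blast
    have "y \<le> - a"
    proof (cases "a \<le> b u")
      case True
      then have "a \<le> ?d" using f by (intro Sup_upper) auto
      then show ?thesis unfolding y_def by (simp add: le_infI2)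
    next
      case False
      then have "b u \<le> - a" using A(3) a by (metis compl_le_swap1)
      then show ?thesis unfolding y_def by (rule le_infI1)
    qed
    then show ?thesis by (simp add: inf_shunt)
  qed
  have "y = bot"
  proof (rule ccontr)
    assume "y \<noteq> bot"
    then have "antichain (insert y A)"
      using A(1) disj by (auto simp: maximal_antichain_def antichain_def inf.commute)
    then have "y \<in> A" using A(1) unfolding maximal_antichain_def by blast
    then show False using disj[of y] \<open>y \<noteq> bot\<close> by simp
  qed
  then show "b u \<le> ?d" by (simp add: y_def inf_shunt)
qed

text \<open>\<open>multiplicative\<close> does not force \<open>b {||}\<close> to be
  \<open>top\<close>, so the empty index set is excluded.\<close>

lemma multiplicative_nonempty_lower_bound:
  assumes "multiplicative b" "v \<noteq> {||}" "\<And>i. i |\<in>| v \<Longrightarrow> x \<le> b {|i|}"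
  shows "x \<le> b v"
  using assms(2,3)
proof (induction v)
  case (insert i v)
  show ?case
  proof (cases "v = {||}")
    case False
    then have "x \<le> inf (b {|i|}) (b v)" using insert by simp
    also have "\<dots> = b ({|i|} |\<union>| v)" using assms(1) by (simp only: multiplicative_def)
    finally show ?thesis by simp
  qed (use insert in simp)
qed simp

theorem theorem9p4:
  assumes "natLeq \<le>o |UNIV :: 'm set|"
    and "|UNIV :: 'm set| <o |UNIV :: 'l set|"
  shows "\<exists>D :: ('l set, 'm) B1 set. perfect_ultrafilter D"
proof -
  have inf_m: "infinite (UNIV :: 'm set)"
    using assms(1) infinite_iff_natLeq_ordLeq by blast
  have ml: "|UNIV :: 'm set| \<le>o |UNIV :: 'l set|" using assms(2) by (rule ordLess_imp_ordLeq)
  have inf_l: "infinite (UNIV :: 'l set)" using inf_m ml card_of_ordLeq_infinite by blast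
  have "|(UNIV :: 'l set set) \<times> (UNIV :: 'l set set)| \<le>o |UNIV :: 'l set set|"
    using inf_l by (intro card_of_Times_ordLeq_infinite card_of_mono1) (auto simp: Finite_Set.finite_set)
  then obtain t :: "'l set \<times> 'l set \<Rightarrow> 'l set" where t: "inj t"
    using card_of_ordLeq[of "UNIV \<times> UNIV" UNIV] by auto
  \<comment> \<open>Rows of an injective pairing: disjoint blocks, each of full size.\<close>
  define W where "W \<alpha> = t ` ({\<alpha>} \<times> UNIV)" for \<alpha>
  have W_disj: "W \<alpha> \<inter> W \<beta> = {}" if "\<alpha> \<noteq> \<beta>" for \<alpha> \<beta>
    using that t by (auto simp: W_def inj_eq)
  have W_card: "|UNIV :: 'l set set| \<le>o |W \<alpha>|" for \<alpha>
  proof (rule card_of_ordLeqI)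
    show "inj (\<lambda>x. t (\<alpha>, x))" by (intro injI) (auto dest: injD[OF t])
  qed (simp add: W_def)
  obtain \<phi> :: "'l set \<Rightarrow> ('l \<Rightarrow> 'l set) \<times> ('l \<Rightarrow> 'l fset \<times> ('l set, 'm) fmap)" where \<phi>: "surj \<phi>"
    using exists_enumeration[OF inf_l ml] by blast
  define b where "b \<alpha> u = Sup (gen ` {f. (u, f) \<in> range (snd (\<phi> \<alpha>))})" for \<alpha> u
  have "\<exists>D. ultrafilter_on D \<and>
    (\<forall>\<alpha> b'. multiplicative b' \<longrightarrow> (\<forall>u. b' u \<le> b \<alpha> u) \<longrightarrow>
      (\<forall>u. supported (b' u) (below \<alpha> \<union> W \<alpha>)) \<longrightarrow>
      (\<forall>u. \<forall>c\<in>D. supported c (below \<alpha>) \<longrightarrow> inf (b' u) c \<noteq> bot) \<longrightarrow>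
      (\<exists>b''. multiplicative b'' \<and> range b'' \<subseteq> D \<and> (\<forall>u. b'' u \<le> b \<alpha> u)))"
    using inf_m W_disj by (rule ultrafilter_construction)
  then obtain D where D: "ultrafilter_on D" and D_perfect:
    "\<forall>\<alpha> b'. multiplicative b' \<longrightarrow> (\<forall>u. b' u \<le> b \<alpha> u) \<longrightarrow>
      (\<forall>u. supported (b' u) (below \<alpha> \<union> W \<alpha>)) \<longrightarrow>
      (\<forall>u. \<forall>c\<in>D. supported c (below \<alpha>) \<longrightarrow> inf (b' u) c \<noteq> bot) \<longrightarrow>
      (\<exists>b''. multiplicative b'' \<and> range b'' \<subseteq> D \<and> (\<forall>u. b'' u \<le> b \<alpha> u))"
    by (elim exE conjE) (rule that)
  have "\<exists>b'. multiplicative b' \<and> range b' \<subseteq> D \<and> (\<forall>u. b' u \<le> b0 u)"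
    if hypothesis: "perfect_hypothesis D b0" for b0
  proof -
    have b0_D: "range b0 \<subseteq> D" and anti: "antimono b0"
      using hypothesis unfolding perfect_hypothesis_def by simp_all
    obtain X where X: "support b0 X" "|X| \<le>o |UNIV :: 'l set|"
      and hyp: "\<forall>\<alpha>. \<Union>{fmdom' f | f. gen f \<in> X} \<subseteq> below \<alpha> \<longrightarrow>
         (\<exists>b'. multiplicative b' \<and> (\<forall>u. b' u \<noteq> bot) \<and> (\<forall>u. b' u \<le> b0 u) \<and>
           (\<forall>c \<in> B1_plus (below \<alpha>) \<inter> D.
             \<forall>S. finite S \<and> S \<subseteq> {sup (b' {|i|}) (- b0 {|i|}) | i. True} \<longrightarrow>
               inf (Inf S) c \<noteq> bot))"
      using hypothesis unfolding perfect_hypothesis_def by (elim conjE exE) (rule that)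
    define F where "F = {f. gen f \<in> X}"
    have "inj_on gen F" using gen_inj[OF inf_m] by (auto intro: inj_onI)
    moreover have "gen ` F \<subseteq> X" by (auto simp: F_def)
    ultimately have F_card: "|F| \<le>o |UNIV :: 'l set|"
      using card_of_ordLeqI[of gen F X] X(2) by (meson ordLeq_transitive image_subset_iff)
    have b0_Sup: "b0 u = Sup (gen ` {f \<in> F. gen f \<le> b0 u})" for u
      using support_eq_Sup[OF X(1)] by (simp add: F_def)
    define C where "C = {(u, f). f \<in> F \<and> gen f \<le> b0 u}"
    have "|(UNIV :: 'l fset set) \<times> F| \<le>o |UNIV :: 'l set|"
      by (intro card_of_Times_ordLeq_infinite inf_l card_of_fset F_card)
    moreover have "C \<subseteq> UNIV \<times> F" by (auto simp: C_def)
    ultimately have "|C| \<le>o |UNIV :: 'l set|" using card_of_mono1 ordLeq_transitive by blast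
    \<comment> \<open>An empty code would make \<open>b0 {||}\<close> zero, although it lies in
      \<open>D\<close>. Only a nonempty \<open>C\<close> is the range of a function.\<close>
    moreover have "C \<noteq> {}"
    proof
      assume "C = {}"
      then have "{f \<in> F. gen f \<le> b0 {||}} = {}" by (auto simp: C_def)
      then have "b0 {||} = bot" using b0_Sup[of "{||}"] by (simp only: image_empty Sup_empty)
      then show False using b0_D D by (metis rangeI subsetD ultrafilter_on_def)
    qed
    ultimately obtain c :: "'l \<Rightarrow> 'l fset \<times> ('l set, 'm) fmap" where c: "range c = C"
      using exists_range by blast
    have dom_card: "|\<Union>f\<in>F. fmdom' f| \<le>o |UNIV :: 'l set|"
      by (intro card_of_UNION_ordLeq_infinite inf_l F_card ballI card_of_finite_ordLeq_infinite) simp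
    have "\<exists>\<omega> :: 'l \<Rightarrow> 'l set. (\<Union>f\<in>F. fmdom' f) \<subseteq> range \<omega>"
      using exists_range[OF dom_card] by (metis empty_subsetI order_refl)
    then obtain \<omega> :: "'l \<Rightarrow> 'l set" where \<omega>: "(\<Union>f\<in>F. fmdom' f) \<subseteq> range \<omega>" by blast
    \<comment> \<open>A stage above all coordinates of the support at which the code of
      \<open>b0\<close> is enumerated.\<close>
    obtain \<alpha> where \<alpha>: "snd (\<phi> \<alpha>) = c" "range \<omega> \<subseteq> below \<alpha>"
      using cofinal_enumeration[OF \<phi> inf_l] by blast
    have b_eq: "b \<alpha> = b0"
      using b0_Sup by (auto simp: b_def \<alpha>(1) c C_def)
    have dom: "fmdom' f \<subseteq> below \<alpha>" if "f \<in> F" for f using that \<omega> \<alpha>(2) by blast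
    have b0_supp: "supported (b0 u) (below \<alpha>)" for u
      by (subst b0_Sup) (rule supported_Sup_gen[OF inf_m], use dom in blast)
    have "\<Union>{fmdom' f | f. gen f \<in> X} \<subseteq> below \<alpha>" using dom by (auto simp: F_def)
    from hyp[rule_format, OF this] obtain b' where b': "multiplicative b'" "\<forall>u. b' u \<le> b0 u"
      and b'_comp: "\<forall>c \<in> B1_plus (below \<alpha>) \<inter> D.
             \<forall>S. finite S \<and> S \<subseteq> {sup (b' {|i|}) (- b0 {|i|}) | i. True} \<longrightarrow>
               inf (Inf S) c \<noteq> bot"
      by (elim exE conjE) (rule that)
    \<comment> \<open>Passes from singletons to arbitrary index sets by testing the hypothesis
      against an element smaller than \<open>d\<close>.\<close>
    have comp: "inf (b' v) d \<noteq> bot" if d: "d \<in> D" "supported d (below \<alpha>)" for v d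
    proof
      assume bot: "inf (b' v) d = bot"
      \<comment> \<open>An arbitrary index, added to make the index set nonempty.\<close>
      obtain i0 :: 'l where True by simp
      define v' where "v' = finsert i0 v"
      define S where "S = (\<lambda>i. sup (b' {|i|}) (- b0 {|i|})) ` fset v'"
      \<comment> \<open>Below \<open>b0 v'\<close> the summands \<open>- b0 {|i|}\<close> with
        \<open>i\<close> in \<open>v'\<close> vanish because \<open>b0\<close> is decreasing,
        leaving \<open>b' {|i|}\<close>.\<close>
      define e where "e = inf d (b0 v')"
      define x where "x = inf (Inf S) e"
      have "e \<in> D" using d(1) b0_D D unfolding e_def ultrafilter_on_def by blast
      moreover have "supported e (below \<alpha>)"
        using supported_Inf[of "{d, b0 v'}" "below \<alpha>"] d(2) b0_supp by (auto simp: e_def)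
      moreover have "e \<noteq> bot" using \<open>e \<in> D\<close> D unfolding ultrafilter_on_def by blast
      ultimately have "e \<in> B1_plus (below \<alpha>) \<inter> D" using supported_in_B1_plus[OF inf_m] by blast
      then have "x \<noteq> bot"
        unfolding x_def by (rule b'_comp[THEN bspec, THEN spec, THEN mp]) (auto simp: S_def)
      have x_le: "x \<le> b' {|i|}" if i: "i |\<in>| v'" for i
      proof -
        have "Inf S \<le> sup (b' {|i|}) (- b0 {|i|})" using i by (intro Inf_lower) (auto simp: S_def)
        then have "x \<le> sup (b' {|i|}) (- b0 {|i|})" unfolding x_def by (rule le_infI1)
        moreover have "b0 v' \<le> b0 {|i|}" using antimonoD[OF anti] i by simp
        then have "x \<le> b0 {|i|}" unfolding x_def e_def by (intro le_infI2)
        ultimately have "x \<le> inf (sup (b' {|i|}) (- b0 {|i|})) (b0 {|i|})" by simp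
        also have "\<dots> \<le> b' {|i|}" by (simp add: inf_sup_distrib2)
        finally show ?thesis .
      qed
      have "v' \<noteq> {||}" by (simp add: v'_def)
      from multiplicative_nonempty_lower_bound[OF b'(1) this x_le] have "x \<le> b' v'" .
      also have "b' v' \<le> b' v"
      proof -
        have "inf (b' {|i0|}) (b' v) = b' ({|i0|} |\<union>| v)"
          using b'(1) by (simp only: multiplicative_def)
        also have "{|i0|} |\<union>| v = v'" by (simp add: v'_def)
        finally show ?thesis by (metis inf.cobounded2)
      qed
      finally have "x \<le> inf (b' v) d" by (simp add: x_def e_def le_infI1 le_infI2)
      then show False using bot \<open>x \<noteq> bot\<close> by (simp add: bot.extremum_unique)
    qed
    from relocation[OF inf_m ml W_card b'(1) spec[OF b'(2)] b0_supp comp]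
    obtain b'' where "multiplicative b''" "\<forall>u. b'' u \<le> b0 u"
      "\<forall>u. supported (b'' u) (below \<alpha> \<union> W \<alpha>)"
      "\<forall>u. \<forall>c\<in>D. supported c (below \<alpha>) \<longrightarrow> inf (b'' u) c \<noteq> bot"
      by blast
    then show ?thesis
      using D_perfect[THEN spec, of \<alpha>, THEN spec, of b''] unfolding b_eq by simp
  qed
  then show ?thesis using D unfolding perfect_ultrafilter_def by blast
qed

end
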